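(* Let $G$ be a biconnected graph. Then: (1) $\chi(G)\le\chi(G')=\max_{A\in\mathrm{Part}(G)}\chi(G'(A))$. (2) $\chi(G)\le\max_{A\in\mathrm{Part}(G)}\chi(G(A))+1$. (3) $\chi(G)\le\max\bigl(3,\ \max_{A}\chi(G(A))+1\bigr)$, where the inner maximum ranges over the parts $A\in\mathrm{Part}(G)$ that are blocks.
   Context: All graphs are finite, undirected, without loops or multiple edges; $G(U)$ is the subgraph induced on $U$; $\chi$ is the chromatic number. A connected component means the vertex set of a maximal connected subgraph. A set $R\subset V(G)$ is a cutset if $G-R$ (delete the vertices of $R$) is disconnected; $\mathfrak R_2(G)$ is the set of 2-vertex cutsets. $R$ separates $X$ from $Y$ (where $X,Y\not\subset R$) if no vertex of $X\setminus R$ and no vertex of $Y\setminus R$ lie in a common connected component of $G-R$; $R$ splits $X$ if $X\setminus R$ is not contained in one connected component of $G-R$. $G$ is $k$-connected if $v(G)>k$ and it has no cutset with at most $k-1$ vertices; biconnected = 2-connected, triconnected = 3-connected. Cutsets $S,T\in\mathfrak R_2(G)$ are independent if neither splits the other; $S$ is single if it is independent with all other cutsets in $\mathfrak R_2(G)$; $\mathfrak O(G)$ is the set of single cutsets. A set $A\subset V(G)$ is a part of $G$ if no cutset of $\mathfrak O(G)$ splits $A$ but every vertex outside $A$ is separated from $A$ by some cutset of $\mathfrak O(G)$; $\mathrm{Part}(G)$ is the set of parts. $G'$ is obtained from $G$ by adding all edges $ab$ with $\{a,b\}\in\mathfrak O(G)$. A part $A$ is a block if $G'(A)$ is triconnected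 (every part is either a block or has $G'(A)$ a simple cycle). The maximum over an empty set is taken to be $-\infty$. *)

theory Defs
  imports "Graph_Theory.Graph_Theory" "HOL-Library.Extended_Real"
begin

text \<open>
  A finite simple undirected graph is a \<^locale>\<open>pair_graph\<close>: a finite loopfree symmetric
  digraph whose arcs are pairs, so that an edge \<open>uv\<close> is the pair of arcs \<open>(u, v)\<close>, \<open>(v, u)\<close>.
  The definitions below are stated for \<^type>\<open>pre_digraph\<close> because induced subgraphs have that
  type; \<^const>\<open>with_proj\<close> is the coercion. They are meant for symmetric digraphs.
\<close>

definition chromatic_number :: "('a, 'b) pre_digraph \<Rightarrow> nat" where
  "chromatic_number G =
    (LEAST k. \<exists>c. c ` verts G \<subseteq> {..<k} \<and> (\<forall>u v. u \<rightarrow>\<^bsub>G\<^esub> v \<longrightarrow> c u \<noteq> c v))"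

text \<open>The qualified name tells graph connectedness from the topological predicate.\<close>

definition components :: "('a, 'b) pre_digraph \<Rightarrow> 'a set set" where
  "components G = verts ` {H. pre_digraph.max_subgraph G Digraph_Component.connected H}"

definition delete_verts :: "('a, 'b) pre_digraph \<Rightarrow> 'a set \<Rightarrow> ('a, 'b) pre_digraph" where
  "delete_verts G R = G \<restriction> (verts G - R)"

text \<open>
  \<^const>\<open>Digraph_Component.connected\<close> is false for the graph without vertices, which must
  not count as disconnected.
\<close>

definition cutset :: "('a, 'b) pre_digraph \<Rightarrow> 'a set \<Rightarrow> bool" where
  "cutset G R \<longleftrightarrow> R \<subseteq> verts G \<and> verts (delete_verts G R) \<noteq> {}
    \<and> \<not> Digraph_Component.connected (delete_verts G R)"

definition two_cutsets :: "('a, 'b) pre_digraph \<Rightarrow> 'a set set" where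
  "two_cutsets G = {R. cutset G R \<and> card R = 2}"

definition k_connected :: "nat \<Rightarrow> ('a, 'b) pre_digraph \<Rightarrow> bool" where
  "k_connected k G \<longleftrightarrow> card (verts G) > k \<and> \<not> (\<exists>R. cutset G R \<and> card R < k)"

text \<open>
  Separation only makes sense if neither set lies inside the cutset; here it is false otherwise.
  Without this, every subset of a single cutset, even the empty set, would be a part.
\<close>

definition separates :: "('a, 'b) pre_digraph \<Rightarrow> 'a set \<Rightarrow> 'a set \<Rightarrow> 'a set \<Rightarrow> bool" where
  "separates G R X Y \<longleftrightarrow> \<not> X \<subseteq> R \<and> \<not> Y \<subseteq> R
    \<and> (\<forall>x \<in> X - R. \<forall>y \<in> Y - R. \<not> (\<exists>C \<in> components (delete_verts G R). x \<in> C \<and> y \<in> C))"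

definition splits :: "('a, 'b) pre_digraph \<Rightarrow> 'a set \<Rightarrow> 'a set \<Rightarrow> bool" where
  "splits G R X \<longleftrightarrow> \<not> (\<exists>C \<in> components (delete_verts G R). X - R \<subseteq> C)"

definition independent_cutsets :: "('a, 'b) pre_digraph \<Rightarrow> 'a set \<Rightarrow> 'a set \<Rightarrow> bool" where
  "independent_cutsets G S T \<longleftrightarrow> \<not> splits G S T \<and> \<not> splits G T S"

definition single_cutsets :: "('a, 'b) pre_digraph \<Rightarrow> 'a set set" where
  "single_cutsets G =
    {S \<in> two_cutsets G. \<forall>T \<in> two_cutsets G. T \<noteq> S \<longrightarrow> independent_cutsets G S T}"

definition parts :: "('a, 'b) pre_digraph \<Rightarrow> 'a set set" where
  "parts G = {A. A \<subseteq> verts G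
    \<and> (\<forall>S \<in> single_cutsets G. \<not> splits G S A)
    \<and> (\<forall>v \<in> verts G - A. \<exists>S \<in> single_cutsets G. separates G S {v} A)}"

text \<open>The graph \<open>G'\<close>.\<close>

definition add_single_edges :: "('a, 'b) pre_digraph \<Rightarrow> 'a pair_pre_digraph" where
  "add_single_edges G =
    \<lparr> pverts = verts G, parcs = arcs_ends G \<union> {(a, b). {a, b} \<in> single_cutsets G} \<rparr>"

definition blocks :: "('a, 'b) pre_digraph \<Rightarrow> 'a set set" where
  "blocks G = {A \<in> parts G. k_connected 3 (add_single_edges G \<restriction> A)}"

text \<open>
  The maximum over a finite family of parts is a supremum in \<^typ>\<open>ereal\<close>, so that it is
  \<open>-\<infinity>\<close> for the empty family.
\<close>

definition max_chromatic :: "('a, 'b) pre_digraph \<Rightarrow> 'a set set \<Rightarrow> ereal" where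
  "max_chromatic G \<A> = (SUP A \<in> \<A>. ereal (real (chromatic_number (G \<restriction> A))))"

end

theory Submission
  imports Defs
begin

text \<open>
  Everything is phrased with separations \<open>(S, X, Y)\<close>: \<open>X\<close> and \<open>Y\<close> are nonempty and disjoint, cover
  the complement of \<open>S\<close>, and no edge joins them. Two separations are uncrossed at a corner
  \<open>Y \<inter> Y'\<close>: if its boundary has at most one vertex, then it is empty by biconnectedness.

  Call a vertex set enclosed if every vertex outside it is separated from it by a single cutset. A
  single cutset \<open>S\<close> that splits an enclosed set \<open>U\<close> lies in \<open>U\<close> and divides it into two smaller
  enclosed sets that meet in \<open>S\<close>; the enclosed sets that are not split are the parts. Hence a
  colouring of the whole graph is glued from colourings of the parts, provided that each part
  admits an extension of any proper colouring of a single cutset inside it. In \<open>G'\<close> the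
  cutset is an edge, so permuting colours suffices. In \<open>G\<close> one spare colour suffices.

  For (3), no spare colour is needed on a part \<open>A\<close> that is not a block, since its vertices have at
  most two neighbours in \<open>A\<close> and three colours can be assigned greedily. Indeed a small cutset of
  \<open>G'(A)\<close> is a cutset of \<open>G\<close> that splits \<open>A\<close>, so it is crossed by another 2-cutset, which also
  lies in \<open>A\<close>. An extremal choice of crossing pairs around \<open>x \<in> A\<close> shows that some 2-cutset
  inside \<open>A\<close> contains all neighbours of \<open>x\<close> in \<open>A\<close>.
\<close>

section \<open>Separations of a biconnected graph\<close>

text \<open>Biconnectedness is stated for bipartitions of the complement, so that the combinatorial
  arguments never mention components or walks.\<close>

locale biconnected =
  fixes V :: "'a set" and E :: "'a rel"
  assumes finite_V: "finite V"
    and sym_E: "(x, y) \<in> E \<Longrightarrow> (y, x) \<in> E"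
    and E_in_V: "(x, y) \<in> E \<Longrightarrow> y \<in> V"
    and irrefl_E: "(x, x) \<notin> E"
    and two_connected: "\<lbrakk>S \<subseteq> V; X \<union> Y = V - S; X \<inter> Y = {}; X \<noteq> {}; Y \<noteq> {};
      \<And>x y. x \<in> X \<Longrightarrow> y \<in> Y \<Longrightarrow> (x, y) \<notin> E\<rbrakk> \<Longrightarrow> 2 \<le> card S"
begin

definition sep :: "'a set \<Rightarrow> 'a set \<Rightarrow> 'a set \<Rightarrow> bool" where
  "sep S X Y \<longleftrightarrow> S \<subseteq> V \<and> X \<union> Y = V - S \<and> X \<inter> Y = {} \<and> X \<noteq> {} \<and> Y \<noteq> {}
    \<and> (\<forall>x\<in>X. \<forall>y\<in>Y. (x, y) \<notin> E)"

definition pair_cut :: "'a set \<Rightarrow> bool" where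
  "pair_cut S \<longleftrightarrow> card S = 2 \<and> (\<exists>X Y. sep S X Y)"

text \<open>The sides of a separation may be unions of several components. Hence some separation has
  A on both sides exactly when the vertices of A outside S do not lie in one component.\<close>

definition divides :: "'a set \<Rightarrow> 'a set \<Rightarrow> bool" where
  "divides S A \<longleftrightarrow> (\<exists>X Y. sep S X Y \<and> A \<inter> X \<noteq> {} \<and> A \<inter> Y \<noteq> {})"

definition single :: "'a set \<Rightarrow> bool" where
  "single S \<longleftrightarrow> pair_cut S \<and> (\<forall>T. pair_cut T \<longrightarrow> \<not> divides S T \<and> \<not> divides T S)"

text \<open>Given \<open>A \<inter> X = {}\<close>, the condition
  \<open>A \<inter> Y \<noteq> {}\<close> says that A is not contained in S.\<close>

definition enclosed :: "'a set \<Rightarrow> bool" where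
  "enclosed A \<longleftrightarrow> A \<subseteq> V \<and> (\<forall>v\<in>V - A. \<exists>S X Y. single S \<and> sep S X Y \<and> v \<in> X
    \<and> A \<inter> X = {} \<and> A \<inter> Y \<noteq> {})"

definition part :: "'a set \<Rightarrow> bool" where
  "part A \<longleftrightarrow> enclosed A \<and> (\<forall>S. single S \<longrightarrow> \<not> divides S A)"

definition virtual :: "'a rel" where
  "virtual = {(a, b). single {a, b}}"

lemma sep_swap: "sep S X Y \<Longrightarrow> sep S Y X"
  unfolding sep_def using sym_E by blast

lemma sepD:
  assumes "sep S X Y"
  shows "S \<subseteq> V" "X \<subseteq> V" "Y \<subseteq> V" "X \<noteq> {}" "Y \<noteq> {}"
  using assms unfolding sep_def by auto

lemma sep_cases:
  assumes "sep S X Y" "v \<in> V"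
  obtains "v \<in> S" | "v \<in> X" | "v \<in> Y"
  using assms unfolding sep_def by blast

lemma sep_disjoint:
  assumes "sep S X Y"
  shows "v \<in> S \<Longrightarrow> v \<notin> X" "v \<in> S \<Longrightarrow> v \<notin> Y" "v \<in> X \<Longrightarrow> v \<notin> Y"
  using assms unfolding sep_def by auto

lemma sep_neighbour:
  assumes "sep S X Y" "(x, y) \<in> E"
  shows "x \<in> X \<Longrightarrow> y \<in> X \<or> y \<in> S" "x \<in> Y \<Longrightarrow> y \<in> Y \<or> y \<in> S"
  using assms E_in_V[OF assms(2)] sym_E[OF assms(2)] unfolding sep_def by auto

lemma sepI_boundary:
  assumes "S \<subseteq> V" "X \<subseteq> V" "S \<inter> X = {}" "X \<noteq> {}" "w \<in> V" "w \<notin> S" "w \<notin> X"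
    and "\<And>x y. x \<in> X \<Longrightarrow> (x, y) \<in> E \<Longrightarrow> y \<in> X \<union> S"
  shows "sep S X (V - S - X)"
  unfolding sep_def using assms by blast

lemma sep_card: "sep S X Y \<Longrightarrow> 2 \<le> card S"
  using two_connected[of S X Y] unfolding sep_def by blast

lemma pair_cutI: "sep S X Y \<Longrightarrow> card S = 2 \<Longrightarrow> pair_cut S"
  unfolding pair_cut_def by blast

lemma singleD: "single S \<Longrightarrow> card S = 2" "single S \<Longrightarrow> pair_cut S"
  "single S \<Longrightarrow> pair_cut T \<Longrightarrow> \<not> divides S T"
  "single S \<Longrightarrow> pair_cut T \<Longrightarrow> \<not> divides T S"
  unfolding single_def pair_cut_def by blast+

section \<open>Empty corners and crossing 2-cutsets\<close>

lemma empty_if_small_boundary: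
  assumes "Z \<subseteq> V" "W \<subseteq> V" "W \<inter> Z = {}" "card W \<le> 1" "v \<in> V" "v \<notin> W" "v \<notin> Z"
    and "\<And>x y. x \<in> Z \<Longrightarrow> (x, y) \<in> E \<Longrightarrow> y \<in> Z \<union> W"
  shows "Z = {}"
proof (rule ccontr)
  assume "Z \<noteq> {}"
  then have "sep W Z (V - W - Z)"
    using assms by (intro sepI_boundary) auto
  then show False
    using sep_card assms(4) by fastforce
qed

text \<open>A neighbour of the corner outside it lies in \<open>S \<inter> T\<close>, in
  \<open>S \<inter> Y'\<close> or in \<open>T \<inter> Y\<close>. The last two are empty, so the
  boundary has at most one vertex.\<close>

lemma corner_empty:
  assumes S: "sep S X Y" and T: "sep T X' Y'"
    and TY: "T \<inter> Y = {}" and SY': "S \<inter> Y' = {}" and card: "card (S \<inter> T) \<le> 1"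
  shows "Y \<inter> Y' = {}"
proof -
  obtain v where v: "v \<in> X" using sepD(4)[OF S] by blast
  show ?thesis
  proof (rule empty_if_small_boundary[OF _ _ _ card])
    show "Y \<inter> Y' \<subseteq> V" "S \<inter> T \<subseteq> V" "v \<in> V" using sepD[OF S] v by auto
    show "S \<inter> T \<inter> (Y \<inter> Y') = {}" using TY by auto
    show "v \<notin> S \<inter> T" "v \<notin> Y \<inter> Y'" using v sep_disjoint[OF S] by auto
    fix x y assume "x \<in> Y \<inter> Y'" "(x, y) \<in> E"
    then have "y \<in> Y \<or> y \<in> S" "y \<in> Y' \<or> y \<in> T"
      using sep_neighbour(2)[OF S] sep_neighbour(2)[OF T] by auto
    then show "y \<in> Y \<inter> Y' \<union> S \<inter> T" using TY SY' by auto
  qed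
qed

lemma meets_pairE:
  assumes "card T = 2" "T \<inter> X \<noteq> {}" "T \<inter> Y \<noteq> {}" and S: "sep S X Y"
  obtains c d where "T = {c, d}" "c \<in> X" "d \<in> Y" "c \<noteq> d"
proof -
  obtain c d where cd: "c \<in> T" "d \<in> T" "c \<in> X" "d \<in> Y" using assms by blast
  moreover have "c \<noteq> d" using cd sep_disjoint(3)[OF S] by blast
  moreover from this have "T = {c, d}" using cd assms(1) by (auto simp: card_2_iff)
  ultimately show ?thesis using that by blast
qed

text \<open>If S missed \<open>X'\<close>, then \<open>X'\<close> would consist of
  \<open>X' \<inter> X\<close> and \<open>X' \<inter> Y\<close>. The boundary of each is the single
  vertex of T on that side of S, so both would be empty.\<close>

lemma crossing_meets_side:
  assumes S: "sep S X Y" "card S = 2" and T: "sep T X' Y'" "card T = 2"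
    and meets: "T \<inter> X \<noteq> {}" "T \<inter> Y \<noteq> {}"
  shows "S \<inter> X' \<noteq> {}"
proof
  assume SX': "S \<inter> X' = {}"
  have *: "X' \<inter> P = {}" if P: "sep S P Q" and cd: "T = {c, d}" "c \<in> P" "d \<in> Q" for P Q c d
  proof (rule empty_if_small_boundary[where W = "{c}" and v = d])
    show "X' \<inter> P \<subseteq> V" "{c} \<subseteq> V" "d \<in> V" using sepD[OF P] cd by auto
    show "{c} \<inter> (X' \<inter> P) = {}" using cd sep_disjoint[OF T(1)] by auto
    show "d \<notin> {c}" "d \<notin> X' \<inter> P" using cd sep_disjoint[OF P] by auto
    fix x y assume "x \<in> X' \<inter> P" "(x, y) \<in> E"
    then have "y \<in> X' \<or> y \<in> T" "y \<in> P \<or> y \<in> S"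
      using sep_neighbour(1)[OF P] sep_neighbour(1)[OF T(1)] by auto
    then show "y \<in> X' \<inter> P \<union> {c}" using cd SX' sep_disjoint[OF P] by auto
  qed simp
  obtain c d where cd: "T = {c, d}" "c \<in> X" "d \<in> Y"
    by (rule meets_pairE[OF T(2) meets S(1)])
  have "X' \<inter> X = {}" "X' \<inter> Y = {}"
    using *[OF S(1) cd] *[OF sep_swap[OF S(1)], of d c] cd by auto
  moreover obtain x where x: "x \<in> X'" using sepD(4)[OF T(1)] by blast
  moreover have "x \<in> V" using sepD(2)[OF T(1)] x by blast
  ultimately show False
    using SX' by (auto elim: sep_cases[OF S(1)])
qed

text \<open>Crossing is symmetric and independent of the chosen sides. If Q divides R, then by
  \<open>crossing_meets_side\<close> Q has both its vertices on different sides of every separation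
  by R; so R divides Q, and the argument can be repeated with the roles exchanged.\<close>

lemma crossing_meets:
  assumes S: "pair_cut S" and T: "pair_cut T" and cross: "divides S T \<or> divides T S"
    and sep: "sep S X Y"
  shows "T \<inter> X \<noteq> {}" "T \<inter> Y \<noteq> {}"
proof -
  have *: "Q \<inter> X' \<noteq> {} \<and> Q \<inter> Y' \<noteq> {}"
    if Q: "pair_cut Q" and R: "card R = 2" "divides Q R" "sep R X' Y'" for Q R X' Y'
  proof -
    obtain P P' where P: "sep Q P P'" "R \<inter> P \<noteq> {}" "R \<inter> P' \<noteq> {}"
      using R(2) unfolding divides_def by blast
    have cQ: "card Q = 2" using Q unfolding pair_cut_def by blast
    show ?thesis
      using crossing_meets_side[OF P(1) cQ R(3,1) P(2,3)]
        crossing_meets_side[OF P(1) cQ sep_swap[OF R(3)] R(1) P(2,3)] by blast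
  qed
  have cards: "card S = 2" "card T = 2" using S T unfolding pair_cut_def by auto
  have "divides T S"
  proof (cases "divides S T")
    case True
    obtain X' Y' where X': "sep T X' Y'" using T unfolding pair_cut_def by blast
    show ?thesis using *[OF S cards(2) True X'] X' unfolding divides_def by blast
  qed (use cross in blast)
  then show "T \<inter> X \<noteq> {}" "T \<inter> Y \<noteq> {}" using *[OF T cards(1) _ sep] by auto
qed

lemma single_avoids_side:
  assumes "single S" "pair_cut T"
  shows "sep S X Y \<Longrightarrow> T \<inter> X = {} \<or> T \<inter> Y = {}" "sep T X Y \<Longrightarrow> S \<inter> X = {} \<or> S \<inter> Y = {}"
  using singleD(3,4)[OF assms] unfolding divides_def by blast+

lemma card_inter_le_one:
  assumes "card S = 2" "w \<in> S" "w \<notin> T"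
  shows "card (S \<inter> T) \<le> 1"
proof -
  have "S \<inter> T \<subset> S" using assms by blast
  then have "card (S \<inter> T) < card S"
    using assms(1) by (intro psubset_card_mono) (auto intro: card_ge_0_finite)
  then show ?thesis using assms(1) by linarith
qed

section \<open>Enclosed sets and single cutsets\<close>

lemma enclosedE:
  assumes "enclosed A" "v \<in> V" "v \<notin> A"
  obtains S X Y where "single S" "sep S X Y" "v \<in> X" "A \<inter> X = {}" "A \<inter> Y \<noteq> {}"
  using assms unfolding enclosed_def by blast

lemma enclosed_sub: "enclosed A \<Longrightarrow> A \<subseteq> V"
  unfolding enclosed_def by blast

text \<open>A vertex v of S outside U would be separated from U by a single cutset T. As S and T do
  not cross, T misses a side Q of S, and S misses the side \<open>Y'\<close> of T. The corner
  \<open>Q \<inter> Y'\<close> is then empty, although it contains the vertices of U in Q.\<close>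

lemma single_sub_enclosed:
  assumes U: "enclosed U" and S: "single S" "sep S X Y" "U \<inter> X \<noteq> {}" "U \<inter> Y \<noteq> {}"
  shows "S \<subseteq> U"
proof
  fix v assume v: "v \<in> S"
  show "v \<in> U"
  proof (rule ccontr)
    assume "v \<notin> U"
    then obtain T X' Y' where T: "single T" "sep T X' Y'" "v \<in> X'" "U \<inter> X' = {}" "U \<inter> Y' \<noteq> {}"
      using enclosedE[OF U] v sepD(1)[OF S(2)] by blast
    have SY': "S \<inter> Y' = {}"
      using single_avoids_side(2)[OF S(1) singleD(2)[OF T(1)] T(2)] v T(3) by blast
    have card: "card (S \<inter> T) \<le> 1"
      using card_inter_le_one[OF singleD(1)[OF S(1)] v] T(3) sep_disjoint[OF T(2)] by blast
    have *: "T \<inter> Q \<noteq> {}" if Q: "sep S P Q" "U \<inter> Q \<noteq> {}" for P Q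
    proof
      assume TQ: "T \<inter> Q = {}"
      have "Q \<inter> Y' = {}" by (rule corner_empty[OF Q(1) T(2) TQ SY' card])
      moreover obtain u where u: "u \<in> U" "u \<in> Q" using Q(2) by blast
      ultimately show False
        using TQ T(4) sepD(3)[OF Q(1)] by (auto elim!: sep_cases[OF T(2), of u])
    qed
    have "T \<inter> X = {} \<or> T \<inter> Y = {}"
      by (rule single_avoids_side(1)[OF S(1) singleD(2)[OF T(1)] S(2)])
    then show False using *[OF S(2,4)] *[OF sep_swap[OF S(2)] S(3)] by blast
  qed
qed

text \<open>Vertices of U beyond S are separated from the half by S itself; those outside U by the
  same cutset T as from U.\<close>

lemma enclosed_half:
  assumes U: "enclosed U" and S: "single S" "sep S X Y" "U \<inter> X \<noteq> {}" "U \<inter> Y \<noteq> {}"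
  shows "enclosed (U \<inter> (X \<union> S))"
  unfolding enclosed_def
proof (intro conjI ballI)
  have SU: "S \<subseteq> U" by (rule single_sub_enclosed[OF assms])
  show "U \<inter> (X \<union> S) \<subseteq> V" using enclosed_sub[OF U] by blast
  fix v assume v: "v \<in> V - U \<inter> (X \<union> S)"
  show "\<exists>T X' Y'. single T \<and> sep T X' Y' \<and> v \<in> X' \<and> U \<inter> (X \<union> S) \<inter> X' = {} \<and> U \<inter> (X \<union> S) \<inter> Y' \<noteq> {}"
  proof (cases "v \<in> U")
    case True
    then have "v \<in> Y" using v by (auto elim: sep_cases[OF S(2)])
    moreover have "U \<inter> (X \<union> S) \<inter> Y = {}" using sep_disjoint[OF S(2)] by auto
    moreover have "U \<inter> (X \<union> S) \<inter> X \<noteq> {}" using S(3) by auto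
    ultimately show ?thesis using S(1) sep_swap[OF S(2)] by metis
  next
    case False
    then obtain T X' Y' where T: "single T" "sep T X' Y'" "v \<in> X'" "U \<inter> X' = {}" "U \<inter> Y' \<noteq> {}"
      using enclosedE[OF U] v by blast
    \<comment> \<open>The half contains S and a vertex of X, hence three vertices, and cannot fit
      into T.\<close>
    have "U \<inter> (X \<union> S) \<inter> Y' \<noteq> {}"
    proof
      assume "U \<inter> (X \<union> S) \<inter> Y' = {}"
      then have sub: "U \<inter> (X \<union> S) \<subseteq> T"
        using T(4) enclosed_sub[OF U] by (auto elim: sep_cases[OF T(2)])
      obtain x where x: "x \<in> U" "x \<in> X" using S(3) by blast
      then have "insert x S \<subseteq> T" using sub SU by blast
      moreover have "card (insert x S) = 3"
        using x singleD(1)[OF S(1)] sep_disjoint(1)[OF S(2), of x] card_ge_0_finite[of S]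
        by (auto simp: card_insert_if)
      moreover have "card T = 2" "finite T"
        using singleD(1)[OF T(1)] card_ge_0_finite[of T] by auto
      ultimately show False using card_mono[of T "insert x S"] by simp
    qed
    moreover have "U \<inter> (X \<union> S) \<inter> X' = {}" using T(4) by blast
    ultimately show ?thesis using T(1-3) by blast
  qed
qed

text \<open>Take a single cutset that separates v from A with the largest possible side X around v.
  If it had a vertex w outside A, a single cutset T separating w from A would not cross it. Then
  either the corner that must contain vertices of A is empty, or the side of T around w strictly
  contains X.\<close>

lemma part_attached:
  assumes A: "enclosed A" and v: "v \<in> V" "v \<notin> A"
  obtains S X Y where "single S" "sep S X Y" "v \<in> X" "A \<inter> X = {}" "A \<inter> Y \<noteq> {}" "S \<subseteq> A"
proof -
  define P where "P X \<longleftrightarrow> (\<exists>S Y. single S \<and> sep S X Y \<and> v \<in> X \<and> A \<inter> X = {} \<and> A \<inter> Y \<noteq> {})" for X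
  have "{X. P X} \<subseteq> Pow V" unfolding P_def by (blast dest: sepD(2))
  then have fin: "finite {X. P X}" using finite_V finite_subset by blast
  obtain S0 X0 Y0 where "single S0" "sep S0 X0 Y0" "v \<in> X0" "A \<inter> X0 = {}" "A \<inter> Y0 \<noteq> {}"
    by (rule enclosedE[OF A v])
  then have "P X0" unfolding P_def by blast
  then have ex: "{X. P X} \<noteq> {}" by blast
  obtain X where PX: "P X" and max: "\<And>Z. P Z \<Longrightarrow> \<not> X \<subset> Z"
    using finite_has_maximal[OF fin ex] by blast
  from PX obtain S Y where S: "single S" "sep S X Y" "v \<in> X" "A \<inter> X = {}" "A \<inter> Y \<noteq> {}"
    unfolding P_def by blast
  have "S \<subseteq> A"
  proof
    fix w assume w: "w \<in> S"
    show "w \<in> A"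
    proof (rule ccontr)
      assume "w \<notin> A"
      then obtain T X' Y' where T: "single T" "sep T X' Y'" "w \<in> X'" "A \<inter> X' = {}" "A \<inter> Y' \<noteq> {}"
        using enclosedE[OF A] w sepD(1)[OF S(2)] by blast
      have SY': "S \<inter> Y' = {}"
        using single_avoids_side(2)[OF S(1) singleD(2)[OF T(1)] T(2)] w T(3) by blast
      have card: "card (S \<inter> T) \<le> 1"
        using card_inter_le_one[OF singleD(1)[OF S(1)] w] T(3) sep_disjoint[OF T(2)] by blast
      have "T \<inter> X = {} \<or> T \<inter> Y = {}"
        by (rule single_avoids_side(1)[OF S(1) singleD(2)[OF T(1)] S(2)])
      then show False
      proof
        assume TY: "T \<inter> Y = {}"
        have "Y \<inter> Y' = {}" by (rule corner_empty[OF S(2) T(2) TY SY' card])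
        moreover obtain u where u: "u \<in> A" "u \<in> Y" using S(5) by blast
        ultimately show False
          using TY T(4) sepD(3)[OF S(2)] by (auto elim!: sep_cases[OF T(2), of u])
      next
        assume TX: "T \<inter> X = {}"
        have "X \<inter> Y' = {}" by (rule corner_empty[OF sep_swap[OF S(2)] T(2) TX SY' card])
        then have XX': "X \<subseteq> X'" using TX sepD(2)[OF S(2)] by (auto elim: sep_cases[OF T(2)])
        moreover have "w \<notin> X" using w sep_disjoint(1)[OF S(2)] by blast
        ultimately have "X \<subset> X'" using T(3) by blast
        moreover have "P X'" unfolding P_def using T S(3) XX' by blast
        ultimately show False using max by blast
      qed
    qed
  qed
  then show ?thesis using that S by blast
qed

text \<open>Every vertex outside A hangs on A by a single cutset inside A. This cutset is a virtual
  edge and cannot meet both X and Y, so the outside vertices can be distributed over the two sides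
  without creating an edge between them.\<close>

lemma sep_of_part_sep:
  assumes A: "enclosed A" and R: "R \<subseteq> A" "card R \<le> 2"
    and XY: "X \<union> Y = A - R" "X \<inter> Y = {}" "X \<noteq> {}" "Y \<noteq> {}"
    and noedge: "\<And>x y. x \<in> X \<Longrightarrow> y \<in> Y \<Longrightarrow> (x, y) \<notin> E \<union> virtual"
  obtains X' Y' where "sep R X' Y'" "X \<subseteq> X'" "Y \<subseteq> Y'" "card R = 2"
proof -
  define att where "att v S P \<longleftrightarrow> single S \<and> (\<exists>Q. sep S P Q) \<and> v \<in> P \<and> A \<inter> P = {} \<and> S \<subseteq> A" for v S P
  have attE: "\<exists>S P. att v S P" if "v \<in> V" "v \<notin> A" for v
    using part_attached[OF A that] unfolding att_def by metis
  have att_nbr: "y \<in> P \<or> y \<in> S" if "att x S P" "(x, y) \<in> E" for x y S P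
    using that sep_neighbour(1) unfolding att_def by metis
  \<comment> \<open>The two vertices of S are joined in \<open>virtual\<close>, so S cannot run from
    X to Y.\<close>
  have att_edge: "y \<in> X \<or> y \<in> R" if "att x S P" "u \<in> S" "u \<in> X" "y \<in> S" for x y S P u
  proof -
    have "card S = 2" "single S" using that(1) singleD(1) unfolding att_def by auto
    then have "u = y \<or> S = {u, y}" using that by (auto simp: card_2_iff)
    then have "y \<notin> Y" using noedge[OF that(3)] \<open>single S\<close> that(3) XY(2) unfolding virtual_def by auto
    moreover have "y \<in> A" using that unfolding att_def by auto
    ultimately show ?thesis using XY(1) by auto
  qed
  \<comment> \<open>An outside vertex joins the side of X as soon as one of its attaching cutsets
    meets X; all others go to the side of Y.\<close>
  define W where "W = X \<union> {v \<in> V - A. \<exists>S P. att v S P \<and> S \<inter> X \<noteq> {}}"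
  have AV: "A \<subseteq> V" by (rule enclosed_sub[OF A])
  obtain w where w: "w \<in> Y" using XY by blast
  have sep: "sep R W (V - R - W)"
  proof (rule sepI_boundary[of R W w])
    fix x y assume x: "x \<in> W" and xy: "(x, y) \<in> E"
    have y: "y \<in> V" by (rule E_in_V[OF xy])
    show "y \<in> W \<union> R"
    proof (cases "x \<in> X")
      case xX: True
      then have xA: "x \<in> A" using XY by blast
      show ?thesis
      proof (cases "y \<in> A")
        case True
        then show ?thesis using noedge[OF xX, of y] xy XY(1) unfolding W_def by auto
      next
        case False
        obtain S P where S: "att y S P" using attE[OF y False] by blast
        have "x \<in> S" using att_nbr[OF S sym_E[OF xy]] xA S unfolding att_def by blast
        then show ?thesis using S xX y False unfolding W_def by blast
      qed
    next
      case False
      then obtain S P u where S: "att x S P" "u \<in> S" "u \<in> X"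
        using x unfolding W_def by blast
      show ?thesis
      proof (cases "y \<in> S")
        case True
        then show ?thesis using att_edge[OF S] unfolding W_def by blast
      next
        case False
        then have "y \<in> P" using att_nbr[OF S(1) xy] by blast
        then have "att y S P" "y \<notin> A" using S(1) unfolding att_def by auto
        then show ?thesis using S(2,3) y unfolding W_def by blast
      qed
    qed
  qed (use w XY R AV in \<open>auto simp: W_def\<close>)
  moreover have "Y \<subseteq> V - R - W" using XY AV unfolding W_def by blast
  moreover have "X \<subseteq> W" unfolding W_def by blast
  moreover have "card R = 2" using sep_card[OF sep] R by simp
  ultimately show ?thesis using that by blast
qed

text \<open>A vertex c of T outside A would be cut off by a single cutset S inside A, with A missing
  the side P of c. Then T misses the other side Q, and S misses a side N of T. The corner
  \<open>Q \<inter> N\<close> is empty, but a vertex of R in N must lie in it.\<close>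

lemma crossing_sub_enclosed:
  assumes A: "enclosed A" and R: "R \<subseteq> A"
    and T: "sep T X' Y'" "card T = 2" and meets: "R \<inter> X' \<noteq> {}" "R \<inter> Y' \<noteq> {}"
  shows "T \<subseteq> A"
proof
  fix c assume c: "c \<in> T"
  show "c \<in> A"
  proof (rule ccontr)
    assume "c \<notin> A"
    then obtain S P Q where S: "single S" "sep S P Q" "c \<in> P" "A \<inter> P = {}" "A \<inter> Q \<noteq> {}" "S \<subseteq> A"
      using part_attached[OF A] c sepD(1)[OF T(1)] by blast
    have T': "pair_cut T" by (rule pair_cutI[OF T])
    have TQ: "T \<inter> Q = {}" using single_avoids_side(1)[OF S(1) T' S(2)] c S(3) by blast
    have card: "card (S \<inter> T) \<le> 1"
      using card_inter_le_one[OF T(2) c, of S] S(3) sep_disjoint[OF S(2)] by (auto simp: Int_commute)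
    have *: "S \<inter> N \<noteq> {}" if N: "sep T M N" "R \<inter> N \<noteq> {}" for M N
    proof
      assume SN: "S \<inter> N = {}"
      have "Q \<inter> N = {}" by (rule corner_empty[OF S(2) N(1) TQ SN card])
      moreover obtain u where u: "u \<in> R" "u \<in> N" using N(2) by blast
      moreover from u have "u \<in> V" using sepD(3)[OF N(1)] by blast
      ultimately show False
        using SN R S(4) by (auto elim!: sep_cases[OF S(2), of u])
    qed
    have "S \<inter> X' = {} \<or> S \<inter> Y' = {}" by (rule single_avoids_side(2)[OF S(1) T' T(1)])
    then show False using *[OF T(1) meets(2)] *[OF sep_swap[OF T(1)] meets(1)] by blast
  qed
qed

text \<open>A 2-cutset that divides a part is not single, so some T crosses it, and
  \<open>crossing_sub_enclosed\<close> keeps T inside the part. The four names record which vertex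
  lies on which side.\<close>

lemma part_crossing:
  assumes A: "part A" and R: "sep R X Y" "card R = 2" "R \<subseteq> A" "A \<inter> X \<noteq> {}" "A \<inter> Y \<noteq> {}"
  obtains T X' Y' u w a c where "T \<subseteq> A" "sep T X' Y'" "T = {u, w}" "R = {a, c}"
    "u \<in> X" "w \<in> Y" "a \<in> X'" "c \<in> Y'"
proof -
  have encl: "enclosed A" using A unfolding part_def by blast
  have pR: "pair_cut R" by (rule pair_cutI[OF R(1,2)])
  have "\<not> single R" using A R unfolding part_def divides_def by blast
  then obtain T where T: "pair_cut T" "divides R T \<or> divides T R"
    using pR unfolding single_def by blast
  then obtain X' Y' where T': "sep T X' Y'" "card T = 2" unfolding pair_cut_def by blast
  have TXY: "T \<inter> X \<noteq> {}" "T \<inter> Y \<noteq> {}" using crossing_meets[OF pR T R(1)] by auto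
  have RXY: "R \<inter> X' \<noteq> {}" "R \<inter> Y' \<noteq> {}" using crossing_meets[OF T(1) pR _ T'(1)] T(2) by auto
  have TA: "T \<subseteq> A" by (rule crossing_sub_enclosed[OF encl R(3) T' RXY])
  obtain u w where uw: "T = {u, w}" "u \<in> X" "w \<in> Y"
    by (rule meets_pairE[OF T'(2) TXY R(1)])
  obtain a c where ac: "R = {a, c}" "a \<in> X'" "c \<in> Y'"
    by (rule meets_pairE[OF R(2) RXY T'(1)])
  show ?thesis
    by (rule that[OF TA T'(1) uw(1) ac(1) uw(2,3) ac(2,3)])
qed

section \<open>Parts split by a 2-cutset\<close>
lemma minimal_setE:
  assumes "P X0" "\<And>X. P X \<Longrightarrow> X \<subseteq> V"
  obtains X where "P X" "\<And>Z. P Z \<Longrightarrow> \<not> Z \<subset> X"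
proof -
  have "{X. P X} \<subseteq> Pow V" using assms(2) by blast
  then have fin: "finite {X. P X}" using finite_V finite_subset by blast
  show ?thesis using finite_has_minimal[OF fin] assms(1) that by blast
qed

lemma crossing_swap_pair:
  assumes "{x, b} = {a, c}" "sep T X' Y'" "a \<in> X'" "c \<in> Y'"
  obtains P Q where "sep T P Q" "x \<in> P" "b \<in> Q"
proof (cases "x = a")
  case True
  then have "b = c" using assms by (auto simp: doubleton_eq_iff)
  then show ?thesis using that[of X' Y'] True assms by simp
next
  case False
  then have "x = c" "b = a" using assms by (auto simp: doubleton_eq_iff)
  then show ?thesis using that[of Y' X'] assms sep_swap by simp
qed

text \<open>It suffices to find a 2-cutset through x inside A that divides A, since
  \<open>part_crossing\<close> then provides the second one. If R avoids x, such a cutset arises by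
  crossing a 2-cutset whose side around x is minimal.\<close>

lemma part_vertex_in_crossing:
  assumes A: "part A" and R: "sep R X Y" "card R = 2" "R \<subseteq> A" "A \<inter> X \<noteq> {}" "A \<inter> Y \<noteq> {}"
    and x: "x \<in> A"
  obtains b c d P Q P' Q' where "sep {x, b} P Q" "sep {c, d} P' Q'" "b \<in> A" "c \<in> A" "d \<in> A"
    "c \<in> P" "d \<in> Q" "x \<in> P'" "b \<in> Q'"
proof -
  note found = that
  have xV: "x \<in> V" using A x unfolding part_def enclosed_def by blast
  have crossing: thesis if b: "sep {x, b} P Q" "b \<in> A" "A \<inter> P \<noteq> {}" "A \<inter> Q \<noteq> {}" for b P Q
  proof -
    have card: "card {x, b} = 2" using sep_card[OF b(1)] by (cases "x = b") auto
    obtain T X' Y' u w a c where T: "T \<subseteq> A" "sep T X' Y'" "T = {u, w}" "{x, b} = {a, c}"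
      "u \<in> P" "w \<in> Q" "a \<in> X'" "c \<in> Y'"
      by (rule part_crossing[OF A b(1) card _ b(3,4)]) (use x b(2) in auto)
    obtain M N where M: "sep T M N" "x \<in> M" "b \<in> N"
      by (rule crossing_swap_pair[OF T(4,2,7,8)])
    have "u \<in> A" "w \<in> A" using T(1,3) by auto
    then show thesis
      using found[OF b(1) M(1)[unfolded T(3)] b(2) _ _ T(5,6) M(2,3)] by blast
  qed
  show thesis
  proof (cases "x \<in> R")
    case True
    obtain b where b: "R = {x, b}" using R(2) True by (auto simp: card_2_iff)
    then have "b \<in> A" using R(3) by simp
    then show thesis using crossing[of b X Y] R(1,4,5) b by simp
  next
    case False
    \<comment> \<open>The demand \<open>A \<inter> W \<noteq> {}\<close>, together with x on the
      other side, makes S divide A, so that it can be crossed again.\<close>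
    define Good where "Good Z \<longleftrightarrow> (\<exists>S W. sep S Z W \<and> card S = 2 \<and> S \<subseteq> A \<and> x \<in> Z \<and> A \<inter> W \<noteq> {})" for Z
    have "x \<in> X \<or> x \<in> Y" using False xV by (auto elim: sep_cases[OF R(1)])
    then have "Good X \<or> Good Y"
      using R sep_swap[OF R(1)] unfolding Good_def by blast
    then obtain X0 where "Good X0" by blast
    then obtain Z where Z: "Good Z" and min: "\<And>Z'. Good Z' \<Longrightarrow> \<not> Z' \<subset> Z"
      by (rule minimal_setE[of Good]) (auto simp: Good_def dest: sepD(2))
    then obtain S W where S: "sep S Z W" "card S = 2" "S \<subseteq> A" "x \<in> Z" "A \<inter> W \<noteq> {}"
      unfolding Good_def by blast
    obtain T X' Y' u w a c where T: "T \<subseteq> A" "sep T X' Y'" "T = {u, w}" "S = {a, c}"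
      "u \<in> Z" "w \<in> W" "a \<in> X'" "c \<in> Y'"
      by (rule part_crossing[OF A S(1-3) _ S(5)]) (use S(4) x in auto)
    have uw: "u \<in> A" "w \<in> A" using T(1,3) by auto
    \<comment> \<open>If x lay on a side M of T, the corner \<open>Z \<inter> M\<close> around x
      would be cut off by \<open>{a', u}\<close>, the vertices of S in M and of T in Z. It lacks u,
      against the minimality of Z. Hence x lies on T, and x = u as w is beyond S.\<close>
    have smaller: False if M: "sep T M N" "x \<in> M" "a' \<in> M" "c' \<in> N" "S = {a', c'}" for M N a' c'
    proof -
      have "sep {a', u} (Z \<inter> M) (V - {a', u} - Z \<inter> M)"
      proof (rule sepI_boundary[of _ _ w])
        show "{a', u} \<subseteq> V" "Z \<inter> M \<subseteq> V" "w \<in> V"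
          using sepD[OF S(1)] M(5) T(5,6) by auto
        show "{a', u} \<inter> (Z \<inter> M) = {}"
          using sep_disjoint[OF S(1)] sep_disjoint[OF M(1)] M(5) T(3) by auto
        show "Z \<inter> M \<noteq> {}" using S(4) M(2) by blast
        show "w \<notin> {a', u}" "w \<notin> Z \<inter> M"
          using sep_disjoint[OF S(1)] T(5,6) M(5) by auto
        fix z y assume "z \<in> Z \<inter> M" "(z, y) \<in> E"
        then have "y \<in> Z \<or> y = a' \<or> y = c'" "y \<in> M \<or> y = u \<or> y = w"
          using sep_neighbour(1)[OF S(1)] sep_neighbour(1)[OF M(1)] M(5) T(3) by auto
        moreover have "c' \<notin> M" "c' \<noteq> u" "c' \<noteq> w" "w \<notin> Z" "w \<noteq> a'"
          using sep_disjoint[OF S(1)] sep_disjoint[OF M(1)] M(4,5) T(5,6) by auto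
        ultimately show "y \<in> Z \<inter> M \<union> {a', u}" by auto
      qed
      moreover have "a' \<noteq> u" "w \<noteq> a'" "w \<notin> Z" "w \<in> V"
        using sep_disjoint[OF S(1)] sepD[OF S(1)] M(5) T(5,6) by auto
      moreover have "w \<noteq> u" using sep_disjoint[OF S(1)] T(5,6) by auto
      moreover have "a' \<in> A" using S(3) M(5) by auto
      ultimately have "Good (Z \<inter> M)"
        unfolding Good_def using S(4) M(2) uw by (intro exI[of _ "{a', u}"] exI conjI) auto
      moreover have "u \<notin> M" using T(3) sep_disjoint(1)[OF M(1)] by blast
      ultimately show False using min T(5) by blast
    qed
    have "x \<notin> X'" using smaller[OF T(2) _ T(7,8,4)] by blast
    moreover have "x \<notin> Y'" using smaller[OF sep_swap[OF T(2)] _ T(8,7)] T(4) by blast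
    moreover have "x \<noteq> w" using S(4) T(6) sep_disjoint(3)[OF S(1)] by blast
    ultimately have "x = u" using xV T(3) by (auto elim: sep_cases[OF T(2)])
    moreover have "A \<inter> X' \<noteq> {}" "A \<inter> Y' \<noteq> {}" using T(4,7,8) S(3) by auto
    ultimately show thesis using crossing[of w X' Y'] T(2,3) uw by simp
  qed
qed

text \<open>Among the separations crossing a fixed \<open>{x, b}\<close>, one with the smallest side around \<open>x\<close>
  has no other vertex of the part on that side.\<close>

lemma part_degree_le_two:
  assumes A: "part A" and R: "sep R X Y" "card R = 2" "R \<subseteq> A" "A \<inter> X \<noteq> {}" "A \<inter> Y \<noteq> {}"
    and x: "x \<in> A"
  shows "\<exists>c d. {y \<in> A. (x, y) \<in> E} \<subseteq> {c, d}"
proof -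
  have AV: "A \<subseteq> V" using A unfolding part_def enclosed_def by blast
  obtain b c0 d0 P Q P0 Q0 where b: "sep {x, b} P Q" "sep {c0, d0} P0 Q0" "b \<in> A" "c0 \<in> A" "d0 \<in> A"
    "c0 \<in> P" "d0 \<in> Q" "x \<in> P0" "b \<in> Q0"
    by (rule part_vertex_in_crossing[OF assms])
  \<comment> \<open>Besides crossing \<open>{x, b}\<close>, the new pair must have x on the side Z
    and b on the other; only the side around x is minimised.\<close>
  define Good where "Good Z \<longleftrightarrow> (\<exists>c d W. sep {c, d} Z W \<and> c \<in> A \<and> d \<in> A \<and> c \<in> P \<and> d \<in> Q \<and> x \<in> Z \<and> b \<in> W)" for Z
  have "Good P0" unfolding Good_def using b by blast
  then obtain Z where Z: "Good Z" and min: "\<And>Z'. Good Z' \<Longrightarrow> \<not> Z' \<subset> Z"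
    by (rule minimal_setE[of Good]) (auto simp: Good_def dest: sepD(2))
  then obtain c d W where T: "sep {c, d} Z W" "c \<in> A" "d \<in> A" "c \<in> P" "d \<in> Q" "x \<in> Z" "b \<in> W"
    unfolding Good_def by blast
  \<comment> \<open>Stated for either side M of \<open>{x, b}\<close>, with e the vertex of the pair
    in M and f the other one. The premise \<open>new\<close> says that replacing e by another vertex
    of A in M keeps the pair admissible.\<close>
  have empty: "A \<inter> (Z \<inter> M) = {}"
    if M: "sep {x, b} M N" "e \<in> M" "f \<in> N" and ef: "sep {e, f} Z W" "e \<in> A" "f \<in> A"
      and new: "\<And>u Z' W'. sep {u, f} Z' W' \<Longrightarrow> u \<in> A \<Longrightarrow> u \<in> M \<Longrightarrow> x \<in> Z' \<Longrightarrow> b \<in> W' \<Longrightarrow> Good Z'"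
    for M N e f
  proof (rule ccontr)
    assume "A \<inter> (Z \<inter> M) \<noteq> {}"
    then obtain q where q: "q \<in> A" "q \<in> Z" "q \<in> M" by blast
    note disj = sep_disjoint[OF ef(1)] sep_disjoint[OF M(1)]
    define O1 where "O1 = Z \<inter> M"
    define O2 where "O2 = V - {x, e} - O1"
    have bV: "b \<in> V" and xV: "x \<in> V" using b(3) x AV by auto
    have bZ: "b \<notin> Z" "b \<noteq> e" "b \<noteq> x" "x \<noteq> e" "b \<noteq> f"
      using T(6,7) disj M(2,3) by auto
    have O: "sep {x, e} O1 O2" unfolding O2_def
    proof (rule sepI_boundary[of _ _ b])
      show "{x, e} \<subseteq> V" "O1 \<subseteq> V" "b \<in> V"
        using ef(2) x AV bV sepD(2)[OF M(1)] by (auto simp: O1_def)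
      show "{x, e} \<inter> O1 = {}" using disj by (auto simp: O1_def)
      show "O1 \<noteq> {}" using q by (auto simp: O1_def)
      show "b \<notin> {x, e}" "b \<notin> O1" using bZ by (auto simp: O1_def)
      fix z y assume "z \<in> O1" "(z, y) \<in> E"
      then have "y \<in> Z \<or> y = e \<or> y = f" "y \<in> M \<or> y = x \<or> y = b"
        using sep_neighbour(1)[OF ef(1)] sep_neighbour(1)[OF M(1)] by (auto simp: O1_def)
      moreover have "f \<notin> M" "f \<noteq> x" using M(3) disj by auto
      ultimately show "y \<in> O1 \<union> {x, e}" using bZ by (auto simp: O1_def)
    qed
    have bO: "b \<in> O2" using bZ bV unfolding O2_def O1_def by blast
    have card: "card {x, e} = 2" using bZ by simp
    \<comment> \<open>The pair \<open>{x, e}\<close> cuts off the corner \<open>O1\<close> and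
      divides A, since q and b lie on different sides. So it is crossed by a pair
      \<open>{u, w}\<close> inside A.\<close>
    obtain U X' Y' u w a c' where U: "U \<subseteq> A" "sep U X' Y'" "U = {u, w}" "{x, e} = {a, c'}"
      "u \<in> O1" "w \<in> O2" "a \<in> X'" "c' \<in> Y'"
      by (rule part_crossing[OF A O card]) (use x ef(2) q bO b(3) in \<open>auto simp: O1_def\<close>)
    obtain XU YU where XU: "sep {u, w} XU YU" "x \<in> XU" "e \<in> YU"
      using crossing_swap_pair[OF U(4,2,7,8)] U(3) by metis
    have uZ: "u \<in> Z" "u \<in> M" "u \<notin> XU" "w \<notin> O1" "u \<in> A"
      using U(1,3,5,6) sep_disjoint[OF XU(1)] sep_disjoint[OF O] by (auto simp: O1_def)
    \<comment> \<open>Within the corner, only the vertices on the side of \<open>{u, w}\<close>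
      containing x are kept. Then \<open>{u, f}\<close> cuts off the remaining set, which has lost u
      and is thus a smaller admissible side around x.\<close>
    define Z' where "Z' = (Z - O1) \<union> (O1 \<inter> XU)"
    have Z'sub: "Z' \<subset> Z" using uZ unfolding Z'_def O1_def by blast
    have xZ': "x \<in> Z'" using T(6) sep_disjoint[OF O] unfolding Z'_def by blast
    have sep': "sep {u, f} Z' (V - {u, f} - Z')"
    proof (rule sepI_boundary[of _ _ b])
      show "{u, f} \<subseteq> V" using uZ(5) ef(3) AV by auto
      show "Z' \<subseteq> V" using Z'sub sepD(2)[OF ef(1)] by auto
      show "{u, f} \<inter> Z' = {}" using uZ disj Z'sub by (auto simp: Z'_def O1_def)
      show "Z' \<noteq> {}" "b \<in> V" using xZ' bV by auto
      show "b \<notin> {u, f}" "b \<notin> Z'" using bZ uZ Z'sub by auto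
      fix z y assume z: "z \<in> Z'" and zy: "(z, y) \<in> E"
      have zZ: "z \<in> Z" using z Z'sub by blast
      have yZ: "y \<in> Z \<or> y = e \<or> y = f" using sep_neighbour(1)[OF ef(1) zy zZ] by auto
      have eXU: "e \<notin> XU" "e \<noteq> u" "e \<noteq> w"
        using sep_disjoint[OF XU(1)] XU(3) by auto
      have zV: "z \<in> V" using zZ sepD(2)[OF ef(1)] by blast
      \<comment> \<open>Only e and w could spoil the boundary \<open>{u, f}\<close>. From z in the
        corner or z = x, the vertex e is out of reach as it lies beyond \<open>{u, w}\<close>; from
        N it is out of reach as it lies beyond \<open>{x, b}\<close>. The removed vertices of the
        corner are excluded likewise, and w is not in the corner.\<close>
      consider "z \<in> O1" "z \<in> XU" | "z = x" | "z \<in> N"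
        using z zZ bZ(1) by (auto simp: Z'_def O1_def intro: sep_cases[OF M(1) zV])
      then show "y \<in> Z' \<union> {u, f}"
      proof cases
        case 1
        have "y \<in> XU \<or> y = u \<or> y = w" using sep_neighbour(1)[OF XU(1) zy 1(2)] by auto
        moreover have "y \<in> O1 \<or> y = x \<or> y = e" using sep_neighbour(1)[OF O zy 1(1)] by auto
        moreover have "w \<noteq> x" using XU(2) sep_disjoint[OF XU(1)] by auto
        ultimately show ?thesis using xZ' eXU uZ(4) by (auto simp: Z'_def)
      next
        case 2
        have "y \<in> XU \<or> y = u \<or> y = w" using sep_neighbour(1)[OF XU(1) zy] XU(2) 2 by auto
        then show ?thesis using yZ eXU uZ(4) by (auto simp: Z'_def)
      next
        case 3
        have "y \<notin> M" using sep_neighbour(2)[OF M(1) zy 3] disj by auto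
        then show ?thesis using yZ M(2) by (auto simp: Z'_def O1_def)
      qed
    qed
    have "b \<in> V - {u, f} - Z'" using bV bZ uZ Z'sub by auto
    then have "Good Z'" using new[OF sep' uZ(5,2) xZ'] by blast
    then show False using min Z'sub by blast
  qed
  have "A \<inter> (Z \<inter> P) = {}"
    by (rule empty[OF b(1) T(4,5,1-3)]) (use T(3,5) in \<open>auto simp: Good_def\<close>)
  moreover have T': "sep {d, c} Z W" using T(1) by (simp add: insert_commute)
  have "A \<inter> (Z \<inter> Q) = {}"
  proof (rule empty[OF sep_swap[OF b(1)] T(5,4) T' T(3,2)])
    fix u Z' W' assume "sep {u, c} Z' W'" "u \<in> A" "u \<in> Q" "x \<in> Z'" "b \<in> W'"
    moreover from this have "sep {c, u} Z' W'" by (simp add: insert_commute)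
    ultimately show "Good Z'" using T(2,4) unfolding Good_def by blast
  qed
  moreover have "b \<notin> Z" using T(7) sep_disjoint(3)[OF T(1)] by blast
  \<comment> \<open>Both corners of Z are free of A, and b is not in Z. So x is alone in Z among the
    vertices of A, and its neighbours in A must lie on the cutset \<open>{c, d}\<close>.\<close>
  ultimately have AZ: "y = x" if "y \<in> A" "y \<in> Z" for y
    using that AV by (auto elim!: sep_cases[OF b(1), of y])
  have "y = c \<or> y = d" if "y \<in> A" "(x, y) \<in> E" for y
    using sep_neighbour(1)[OF T(1) that(2) T(6)] AZ[OF that(1)] irrefl_E that(2) by auto
  then have "{y \<in> A. (x, y) \<in> E} \<subseteq> {c, d}" by blast
  then show ?thesis by blast
qed

end

section \<open>Colourings\<close>

definition colouring :: "'a rel \<Rightarrow> nat \<Rightarrow> 'a set \<Rightarrow> ('a \<Rightarrow> nat) \<Rightarrow> bool" where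
  "colouring F K A c \<longleftrightarrow> c ` A \<subseteq> {..<K} \<and> (\<forall>u\<in>A. \<forall>v\<in>A. (u, v) \<in> F \<longrightarrow> c u \<noteq> c v)"

text \<open>For empty B this is plain colourability, so a single induction can treat the colouring
  of V and the extension from a cutset.\<close>

definition extendable :: "'a rel \<Rightarrow> nat \<Rightarrow> 'a set \<Rightarrow> 'a set \<Rightarrow> bool" where
  "extendable F K A B \<longleftrightarrow>
    (\<forall>c0. colouring F K B c0 \<longrightarrow> (\<exists>c. colouring F K A c \<and> (\<forall>s\<in>B. c s = c0 s)))"

lemma colouring_subset: "colouring F K A c \<Longrightarrow> B \<subseteq> A \<Longrightarrow> colouring F K B c"
  unfolding colouring_def by blast

lemma colouring_mono: "colouring F k A c \<Longrightarrow> k \<le> K \<Longrightarrow> colouring F K A c"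
  unfolding colouring_def by (auto simp: image_subset_iff intro: less_le_trans)

lemma colouring_cong:
  "colouring F K A c \<Longrightarrow> (\<And>v. v \<in> A \<Longrightarrow> c' v = c v) \<Longrightarrow> colouring F K A c'"
  unfolding colouring_def by (simp add: image_subset_iff)

lemma extendable_empty_iff: "extendable F K A {} \<longleftrightarrow> (\<exists>c. colouring F K A c)"
  unfolding extendable_def colouring_def by simp

lemma colouring_glue:
  assumes c1: "colouring F K A1 c1" and c2: "colouring F K A2 c2"
    and agree: "\<And>v. v \<in> A1 \<Longrightarrow> v \<in> A2 \<Longrightarrow> c1 v = c2 v"
    and noedge: "\<And>u v. u \<in> A1 - A2 \<Longrightarrow> v \<in> A2 - A1 \<Longrightarrow> (u, v) \<notin> F \<and> (v, u) \<notin> F"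
  obtains c where "colouring F K (A1 \<union> A2) c" "\<And>v. v \<in> A1 \<Longrightarrow> c v = c1 v" "\<And>v. v \<in> A2 \<Longrightarrow> c v = c2 v"
proof -
  define c where "c v = (if v \<in> A1 then c1 v else c2 v)" for v
  have eq: "\<And>v. v \<in> A1 \<Longrightarrow> c v = c1 v" "\<And>v. v \<in> A2 \<Longrightarrow> c v = c2 v"
    unfolding c_def using agree by auto
  have "colouring F K A1 c" "colouring F K A2 c"
    using colouring_cong[OF c1, of c] colouring_cong[OF c2, of c] eq by auto
  note col = this
  have "c u \<noteq> c v" if "u \<in> A1 \<union> A2" "v \<in> A1 \<union> A2" "(u, v) \<in> F" for u v
  proof -
    have "u \<in> A1 \<and> v \<in> A1 \<or> u \<in> A2 \<and> v \<in> A2" using noedge[of u v] noedge[of v u] that by blast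
    then show ?thesis using col that(3) unfolding colouring_def by blast
  qed
  moreover have "c ` (A1 \<union> A2) \<subseteq> {..<K}" using col unfolding colouring_def by (simp add: image_Un)
  ultimately have "colouring F K (A1 \<union> A2) c" unfolding colouring_def by blast
  then show ?thesis using that eq by blast
qed

lemma ex_bij_two_points:
  fixes p q \<alpha> \<beta> K :: nat
  assumes "p < K" "q < K" "\<alpha> < K" "\<beta> < K" "p = q \<longleftrightarrow> \<alpha> = \<beta>"
  obtains f where "inj f" "f ` {..<K} \<subseteq> {..<K}" "f p = \<alpha>" "f q = \<beta>"
proof -
  \<comment> \<open>The first transposition sends p to \<alpha>. The second sends the image of q to
    \<beta>, and it fixes \<alpha> because p = q exactly when \<alpha> = \<beta>.\<close>
  define f where "f = transpose (transpose p \<alpha> q) \<beta> \<circ> transpose p \<alpha>"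
  have "inj f" unfolding f_def by (intro inj_compose inj_transpose)
  moreover have "transpose x y z < K" if "x < K" "y < K" "z < K" for x y z
    using that by (simp add: transpose_def)
  then have "f ` {..<K} \<subseteq> {..<K}" using assms(1-4) by (auto simp: f_def)
  moreover have "f p = \<alpha>" "f q = \<beta>" using assms(5) by (auto simp: f_def transpose_def)
  ultimately show ?thesis using that by blast
qed

text \<open>Permuting colours keeps a colouring proper, and it can realise any prescribed values on
  two vertices with the same pattern of equality.\<close>

lemma recolour_pair:
  assumes c: "colouring F K A c" and ab: "a \<in> A" "b \<in> A"
    and c0: "c0 a < K" "c0 b < K" "c a = c b \<longleftrightarrow> c0 a = c0 b"
  shows "\<exists>c'. colouring F K A c' \<and> (\<forall>s\<in>{a, b}. c' s = c0 s)"
proof -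
  have "c a < K" "c b < K" using c ab unfolding colouring_def by auto
  then obtain f where f: "inj f" "f ` {..<K} \<subseteq> {..<K}" "f (c a) = c0 a" "f (c b) = c0 b"
    using ex_bij_two_points[of "c a" K "c b" "c0 a" "c0 b"] c0 by auto
  have "colouring F K A (f \<circ> c)"
    using c f(1,2) unfolding colouring_def by (auto simp: inj_eq image_subset_iff)
  then show ?thesis using f(3,4) by (intro exI[of _ "f \<circ> c"]) auto
qed

text \<open>Both colourings are proper on the edge ab, so each gives its ends distinct colours and a
  permutation of colours turns one into the other there.\<close>

lemma extendable_edge:
  assumes c: "colouring F K A c" and ab: "a \<in> A" "b \<in> A" "(a, b) \<in> F"
  shows "extendable F K A {a, b}"
  unfolding extendable_def
proof (intro allI impI)
  fix c0 assume "colouring F K {a, b} c0"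
  moreover have "c a \<noteq> c b" using c ab unfolding colouring_def by blast
  ultimately show "\<exists>c'. colouring F K A c' \<and> (\<forall>s\<in>{a, b}. c' s = c0 s)"
    using ab by (intro recolour_pair[OF c]) (auto simp: colouring_def)
qed

text \<open>The spare colour \<open>k\<close> is given to \<open>b\<close> alone or to both \<open>a\<close> and \<open>b\<close>, according to whether the
  prescribed colours differ.\<close>

lemma extendable_spare_colour:
  assumes c: "colouring F k A c" and K: "k < K" and ab: "a \<in> A" "b \<in> A" "a \<noteq> b"
  shows "extendable F K A {a, b}"
  unfolding extendable_def
proof (intro allI impI)
  fix c0 assume c0: "colouring F K {a, b} c0"
  define c' where "c' = (if c0 a = c0 b then c(a := k, b := k) else c(b := k))"
  have ck: "c v < k" if "v \<in> A" for v using c that unfolding colouring_def by auto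
  have irrefl: "(v, v) \<notin> F" if "v \<in> A" for v using c that unfolding colouring_def by blast
  \<comment> \<open>Equal prescribed colours force a and b to be nonadjacent, so both may receive
    k.\<close>
  have c0': "c0 a = c0 b \<Longrightarrow> (a, b) \<notin> F \<and> (b, a) \<notin> F"
    using c0 unfolding colouring_def by auto
  have "c' ` A \<subseteq> {..<K}"
    using ck K by (fastforce simp: c'_def)
  moreover have "c' u \<noteq> c' v" if uv: "u \<in> A" "v \<in> A" "(u, v) \<in> F" for u v
  proof -
    have "c u \<noteq> c v" "u \<noteq> v" using c uv irrefl unfolding colouring_def by blast+
    then show ?thesis
      using ck[OF uv(1)] ck[OF uv(2)] c0' uv(3) by (auto simp: c'_def)
  qed
  ultimately have "colouring F K A c'" unfolding colouring_def by blast
  moreover have "c' a = c' b \<longleftrightarrow> c0 a = c0 b"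
    using ck[OF ab(1)] ab(3) by (auto simp: c'_def)
  moreover have "c0 a < K" "c0 b < K" using c0 unfolding colouring_def by auto
  ultimately show "\<exists>c. colouring F K A c \<and> (\<forall>s\<in>{a, b}. c s = c0 s)"
    by (intro recolour_pair[of F K A c'] ab) auto
qed

text \<open>Greedy colouring: the vertices of D are added one by one while B keeps its colours. Each
  new vertex sees at most two coloured neighbours, so one of three colours is free.\<close>

lemma extendable_degree_two:
  assumes "finite D" "3 \<le> K" "sym F" "irrefl F"
    and deg: "\<And>x. x \<in> D \<Longrightarrow> \<exists>c d. {y \<in> B \<union> D. (x, y) \<in> F} \<subseteq> {c, d}"
  shows "extendable F K (B \<union> D) B"
  using assms(1,5)
proof (induction D rule: finite_induct)
  case empty
  then show ?case unfolding extendable_def by auto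
next
  case (insert x D)
  have IH: "extendable F K (B \<union> D) B"
  proof (rule insert.IH)
    fix z assume "z \<in> D"
    then obtain c d where "{y \<in> B \<union> insert x D. (z, y) \<in> F} \<subseteq> {c, d}"
      using insert.prems by blast
    then show "\<exists>c d. {y \<in> B \<union> D. (z, y) \<in> F} \<subseteq> {c, d}" by blast
  qed
  show ?case
  proof (cases "x \<in> B")
    case True
    then show ?thesis using IH by (simp add: insert_absorb)
  next
    case False
    show ?thesis unfolding extendable_def
    proof (intro allI impI)
      fix c0 assume "colouring F K B c0"
      then obtain c where c: "colouring F K (B \<union> D) c" "\<forall>s\<in>B. c s = c0 s"
        using IH unfolding extendable_def by blast
      obtain p q where pq: "{y \<in> B \<union> insert x D. (x, y) \<in> F} \<subseteq> {p, q}"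
        using insert.prems by blast
      \<comment> \<open>The vertices p and q need not be coloured neighbours of x; avoiding their
        two values is affordable in any case.\<close>
      have "\<not> {..<K} \<subseteq> {c p, c q}"
      proof
        assume "{..<K} \<subseteq> {c p, c q}"
        then have "card {..<K} \<le> card {c p, c q}" by (intro card_mono) auto
        also have "\<dots> \<le> 2" by (simp add: card_insert_if)
        finally show False using \<open>3 \<le> K\<close> by simp
      qed
      then obtain k where k: "k < K" "k \<noteq> c p" "k \<noteq> c q" by blast
      have nbr: "c y \<noteq> k" if "y \<in> B \<union> D" "(x, y) \<in> F \<or> (y, x) \<in> F" for y
        using that pq k symD[OF \<open>sym F\<close>] by blast
      have "(x, x) \<notin> F" using \<open>irrefl F\<close> by (simp add: irrefl_def)
      have xBD: "x \<notin> B \<union> D" using False insert.hyps(2) by blast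
      define c' where "c' = c(x := k)"
      have c': "c' x = k" "\<And>y. y \<in> B \<union> D \<Longrightarrow> c' y = c y" using xBD unfolding c'_def by auto
      have "c' u \<noteq> c' v" if uv: "u \<in> insert x (B \<union> D)" "v \<in> insert x (B \<union> D)" "(u, v) \<in> F" for u v
      proof -
        consider "u = x" "v \<in> B \<union> D" | "v = x" "u \<in> B \<union> D" | "u \<in> B \<union> D" "v \<in> B \<union> D"
          using uv \<open>(x, x) \<notin> F\<close> by blast
        then show ?thesis
        proof cases
          case 1
          then show ?thesis using nbr[OF 1(2)] uv(3) c' by auto
        next
          case 2
          then show ?thesis using nbr[OF 2(2)] uv(3) c' by auto
        next
          case 3
          then show ?thesis using c(1) uv(3) unfolding c'(2)[OF 3(1)] c'(2)[OF 3(2)] colouring_def by blast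
        qed
      qed
      moreover have "c' y < K" if "y \<in> insert x (B \<union> D)" for y
      proof (cases "y = x")
        case False
        then have y: "y \<in> B \<union> D" using that by blast
        then show ?thesis using c(1) unfolding c'(2)[OF y] colouring_def by blast
      qed (simp add: c' k)
      ultimately have "colouring F K (B \<union> insert x D) c'" unfolding colouring_def by auto
      then show "\<exists>c. colouring F K (B \<union> insert x D) c \<and> (\<forall>s\<in>B. c s = c0 s)"
        using c(2) False by (intro exI[of _ c']) (auto simp: c'_def)
    qed
  qed
qed

section \<open>Gluing colourings along single cutsets\<close>

context biconnected begin

text \<open>A virtual edge from X to Y would be a single cutset divided by the 2-cutset S. This
  allows gluing along S in the presence of virtual edges.\<close>

lemma virtual_avoids_sep:
  assumes "pair_cut S" "sep S X Y" "x \<in> X" "y \<in> Y"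
  shows "(x, y) \<notin> virtual" "(y, x) \<notin> virtual"
  using single_avoids_side(2)[OF _ assms(1,2), of "{x, y}"] assms(3,4)
  by (auto simp: virtual_def insert_commute)

text \<open>Induction on U, split along a single cutset S. The empty B serves for the whole graph; S
  itself takes the role of B when the second half is coloured.\<close>

lemma enclosed_extendable:
  assumes F: "F \<subseteq> E \<union> virtual"
    and parts: "\<And>A B. \<lbrakk>part A; B \<subseteq> A; B = {} \<or> single B\<rbrakk> \<Longrightarrow> extendable F K A B"
    and U: "enclosed U" "B \<subseteq> U" "B = {} \<or> single B"
  shows "extendable F K U B"
proof -
  have "finite U" using enclosed_sub[OF U(1)] finite_V finite_subset by blast
  then show ?thesis using U
  proof (induction U arbitrary: B rule: finite_psubset_induct)
    case (psubset U)
    show ?case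
    proof (cases "part U")
      case True
      then show ?thesis using parts psubset.prems by blast
    next
      case False
      then obtain S X Y where S: "single S" "sep S X Y" "U \<inter> X \<noteq> {}" "U \<inter> Y \<noteq> {}"
        using psubset.prems(1) unfolding part_def divides_def by blast
      \<comment> \<open>B does not cross S, so it misses one side, here called Y. The half with B is
        coloured first, and the other half then extends the colours that S has received.\<close>
      have glue: "extendable F K U B"
        if S: "sep S X Y" "U \<inter> X \<noteq> {}" "U \<inter> Y \<noteq> {}" and BY: "B \<inter> Y = {}" for X Y
        unfolding extendable_def
      proof (intro allI impI)
        define U1 where "U1 = U \<inter> (X \<union> S)"
        define U2 where "U2 = U \<inter> (Y \<union> S)"
        have SU: "S \<subseteq> U" by (rule single_sub_enclosed[OF psubset.prems(1) \<open>single S\<close> S])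
        have encl: "enclosed U1" "enclosed U2"
          using enclosed_half[OF psubset.prems(1) \<open>single S\<close> S]
            enclosed_half[OF psubset.prems(1) \<open>single S\<close> sep_swap[OF S(1)] S(3,2)]
          unfolding U1_def U2_def by auto
        have sub: "U1 \<subset> U" "U2 \<subset> U"
          using S(2,3) sep_disjoint[OF S(1)] unfolding U1_def U2_def by blast+
        have UU: "U1 \<union> U2 = U" "U1 \<inter> U2 = S"
          using SU sep_disjoint[OF S(1)] enclosed_sub[OF psubset.prems(1)]
          unfolding U1_def U2_def by (auto elim: sep_cases[OF S(1)])
        have BU1: "B \<subseteq> U1" using BY psubset.prems(2) UU unfolding U2_def U1_def by blast
        fix c0 assume c0: "colouring F K B c0"
        obtain c1 where c1: "colouring F K U1 c1" "\<forall>s\<in>B. c1 s = c0 s"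
          using psubset.IH[OF sub(1) encl(1) BU1 psubset.prems(3)] c0 unfolding extendable_def by blast
        have "colouring F K S c1" by (rule colouring_subset[OF c1(1)]) (use UU in blast)
        moreover have "extendable F K U2 S"
          by (rule psubset.IH[OF sub(2) encl(2)]) (use UU \<open>single S\<close> in auto)
        ultimately obtain c2 where c2: "colouring F K U2 c2" "\<forall>s\<in>S. c2 s = c1 s"
          unfolding extendable_def by blast
        obtain c where c: "colouring F K (U1 \<union> U2) c" "\<And>v. v \<in> U1 \<Longrightarrow> c v = c1 v"
        proof (rule colouring_glue[OF c1(1) c2(1)])
          fix v assume "v \<in> U1" "v \<in> U2"
          then show "c1 v = c2 v" using UU(2) c2(2) by auto
        next
          fix u v assume "u \<in> U1 - U2" "v \<in> U2 - U1"
          then have uv: "u \<in> X" "v \<in> Y" unfolding U1_def U2_def by auto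
          then have "(u, v) \<notin> E" "(v, u) \<notin> E"
            using sep_neighbour[OF S(1)] sep_disjoint[OF S(1)] by blast+
          then show "(u, v) \<notin> F \<and> (v, u) \<notin> F"
            using virtual_avoids_sep[OF singleD(2)[OF \<open>single S\<close>] S(1) uv] F by blast
        qed blast
        have "\<forall>s\<in>B. c s = c0 s" using c(2) c1(2) BU1 by auto
        then show "\<exists>c. colouring F K U c \<and> (\<forall>s\<in>B. c s = c0 s)"
          using c(1) UU(1) by auto
      qed
      have "B \<inter> X = {} \<or> B \<inter> Y = {}"
        using psubset.prems(3) single_avoids_side(1)[OF S(1) singleD(2) S(2)] by blast
      then show ?thesis
        using glue[OF S(2-4)] glue[OF sep_swap[OF S(2)] S(4,3)] by blast
    qed
  qed
qed

lemma enclosed_V: "enclosed V"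
  unfolding enclosed_def by blast

lemma colouring_V_from_parts:
  assumes "F \<subseteq> E \<union> virtual"
    and "\<And>A. part A \<Longrightarrow> \<exists>c. colouring F K A c"
    and "\<And>A S. \<lbrakk>part A; S \<subseteq> A; single S\<rbrakk> \<Longrightarrow> extendable F K A S"
  shows "\<exists>c. colouring F K V c"
  using enclosed_extendable[OF assms(1) _ enclosed_V empty_subsetI, of K] assms(2,3)
  unfolding extendable_empty_iff by (metis extendable_empty_iff)

lemma colouring_V_with_virtual:
  assumes parts: "\<And>A. part A \<Longrightarrow> \<exists>c. colouring (E \<union> virtual) K A c"
  shows "\<exists>c. colouring (E \<union> virtual) K V c"
proof (rule colouring_V_from_parts[OF subset_refl parts])
  fix A S assume A: "part A" "S \<subseteq> A" and S: "single S"
  obtain a b where ab: "S = {a, b}" using singleD(1)[OF S] by (auto simp: card_2_iff)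
  obtain c where c: "colouring (E \<union> virtual) K A c" using parts[OF A(1)] by blast
  show "extendable (E \<union> virtual) K A S"
    unfolding ab by (rule extendable_edge[OF c]) (use A(2) S ab in \<open>auto simp: virtual_def\<close>)
qed

lemma spare_colour_single:
  assumes "colouring E k A c" "k < K" "S \<subseteq> A" "single S"
  shows "extendable E K A S"
proof -
  obtain a b where ab: "S = {a, b}" "a \<noteq> b" using singleD(1)[OF assms(4)] by (auto simp: card_2_iff)
  show ?thesis
    unfolding ab(1) using assms(3) ab by (intro extendable_spare_colour[OF assms(1,2)]) auto
qed

text \<open>Triconnectedness of \<open>G'(A)\<close>, written with bipartitions so that it can be
  fed to \<open>sep_of_part_sep\<close>.\<close>

definition triconnected_part :: "'a set \<Rightarrow> bool" where
  "triconnected_part A \<longleftrightarrow> 3 < card A \<and> \<not> (\<exists>R X Y. R \<subseteq> A \<and> card R \<le> 2 \<and> X \<union> Y = A - R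
    \<and> X \<inter> Y = {} \<and> X \<noteq> {} \<and> Y \<noteq> {} \<and> (\<forall>x\<in>X. \<forall>y\<in>Y. (x, y) \<notin> E \<union> virtual))"

lemma subset_pair_if_card_le_two:
  assumes "finite S" "card S \<le> 2"
  shows "\<exists>c d. S \<subseteq> {c, d}"
proof -
  have "card S = 0 \<or> card S = 1 \<or> card S = 2" using assms(2) by linarith
  then show ?thesis using assms(1) by (auto simp: card_1_singleton_iff card_2_iff)
qed

text \<open>All degrees inside A are at most two, so the greedy extension applies. This is immediate
  for at most three vertices; otherwise a small separation of \<open>G'(A)\<close> extends to a
  2-cutset of the graph dividing A, and \<open>part_degree_le_two\<close> gives the bound.\<close>

lemma non_triconnected_part_extendable:
  assumes A: "part A" and nontri: "\<not> triconnected_part A" and K: "3 \<le> K" and B: "B \<subseteq> A"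
  shows "extendable E K A B"
proof -
  have AV: "A \<subseteq> V" using A enclosed_sub unfolding part_def by blast
  have fin: "finite A" using AV finite_V finite_subset by blast
  have deg: "\<exists>c d. {y \<in> A. (x, y) \<in> E} \<subseteq> {c, d}" if x: "x \<in> A" for x
  proof (cases "3 < card A")
    case True
    then obtain R X Y where R: "R \<subseteq> A" "card R \<le> 2" "X \<union> Y = A - R" "X \<inter> Y = {}" "X \<noteq> {}" "Y \<noteq> {}"
      and noedge: "\<And>x y. x \<in> X \<Longrightarrow> y \<in> Y \<Longrightarrow> (x, y) \<notin> E \<union> virtual"
      using nontri unfolding triconnected_part_def by blast
    have encl: "enclosed A" using A unfolding part_def by blast
    obtain X' Y' where S: "sep R X' Y'" "X \<subseteq> X'" "Y \<subseteq> Y'" "card R = 2"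
      by (rule sep_of_part_sep[OF encl R noedge])
    have "A \<inter> X' \<noteq> {}" "A \<inter> Y' \<noteq> {}" using S(2,3) R(3,5,6) by blast+
    then show ?thesis by (rule part_degree_le_two[OF A S(1,4) R(1) _ _ x])
  next
    case False
    have "card {y \<in> A. (x, y) \<in> E} \<le> card (A - {x})"
      using fin irrefl_E by (intro card_mono) auto
    then have "card {y \<in> A. (x, y) \<in> E} \<le> 2" using False x fin by simp
    then show ?thesis using fin by (intro subset_pair_if_card_le_two) auto
  qed
  have BA: "B \<union> (A - B) = A" using B by blast
  have "extendable E K (B \<union> (A - B)) B"
  proof (rule extendable_degree_two[OF _ K])
    show "finite (A - B)" using fin by blast
    show "sym E" using sym_E by (auto intro: symI)
    show "irrefl E" using irrefl_E by (auto simp: irrefl_def)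
    show "\<exists>c d. {y \<in> B \<union> (A - B). (x, y) \<in> E} \<subseteq> {c, d}" if "x \<in> A - B" for x
      unfolding BA using deg that by blast
  qed
  then show ?thesis by (simp only: BA)
qed

text \<open>Common source of the second and third bound: each part extends colours from its single
  cutsets either by a spare colour, hence k < K, or greedily.\<close>

lemma colouring_V_from_blocks:
  assumes parts: "\<And>A. part A \<Longrightarrow> (\<exists>k<K. \<exists>c. colouring E k A c) \<or> 3 \<le> K \<and> \<not> triconnected_part A"
  shows "\<exists>c. colouring E K V c"
proof (rule colouring_V_from_parts)
  fix A assume A: "part A"
  show "\<exists>c. colouring E K A c"
    using parts[OF A]
  proof
    assume "\<exists>k<K. \<exists>c. colouring E k A c"
    then show ?thesis using colouring_mono less_imp_le by blast
  next
    assume "3 \<le> K \<and> \<not> triconnected_part A"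
    then show ?thesis
      using non_triconnected_part_extendable[OF A, of K "{}"] by (simp add: extendable_empty_iff)
  qed
next
  fix A S assume A: "part A" "S \<subseteq> A" "single S"
  show "extendable E K A S"
    using parts[OF A(1)] non_triconnected_part_extendable[OF A(1) _ _ A(2), of K]
      spare_colour_single[OF _ _ A(2,3), of _ _ K] by blast
qed blast

end

section \<open>Components and separations\<close>

text \<open>Monotonicity under adding arcs on a fixed vertex set is what makes maximal connected
  subgraphs induced.\<close>

lemma arc_mono_connected: "arc_mono Digraph_Component.connected"
  unfolding arc_mono_def
proof (intro allI impI)
  fix H1 H2 :: "('a, 'b) pre_digraph"
  assume H: "Digraph_Component.connected H1 \<and> subgraph H1 H2 \<and> verts H1 = verts H2"
  then interpret wf_digraph H2 by (auto simp: subgraph_def)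
  show "Digraph_Component.connected H2"
    using H connected_spanning_imp_connected[of H1] by (simp add: spanning_def)
qed

text \<open>In a symmetric digraph these are the unions of connected components of
  \<open>delete_verts G R\<close>, described without reachability.\<close>

definition no_exit :: "('a, 'b) pre_digraph \<Rightarrow> 'a set \<Rightarrow> 'a set \<Rightarrow> bool" where
  "no_exit G R X \<longleftrightarrow> X \<subseteq> verts G - R \<and> (\<forall>x\<in>X. \<forall>y\<in>verts G - R - X. \<not> x \<rightarrow>\<^bsub>G\<^esub> y)"

lemma no_exit_subset: "no_exit G R X \<Longrightarrow> X \<subseteq> verts G - R"
  unfolding no_exit_def by blast

context sym_digraph begin

lemma connected_iff_strongly_connected:
  "Digraph_Component.connected G \<longleftrightarrow> strongly_connected G"
  using symmetric_connected_imp_strongly_connected[OF sym_arcs] reachable_mk_symmetricI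
  by (auto simp: Digraph_Component.connected_def strongly_connected_def)

lemma induced_connected_iff:
  "induced_subgraph H G \<Longrightarrow> Digraph_Component.connected H \<longleftrightarrow> strongly_connected H"
  by (rule sym_digraph.connected_iff_strongly_connected[OF induced_graph_imp_graph])

text \<open>A maximal connected subgraph is induced, hence symmetric, so that weak and strong
  connectedness agree on it.\<close>

lemma max_connected_subgraph_iff:
  "max_subgraph Digraph_Component.connected H \<longleftrightarrow> max_subgraph strongly_connected H"
proof
  assume H: "max_subgraph Digraph_Component.connected H"
  then have ind: "induced_subgraph H G" by (rule induced_subgraphI_arc_mono[OF _ arc_mono_connected])
  show "max_subgraph strongly_connected H"
  proof (rule max_subgraphI)
    show "strongly_connected H" using max_subgraph_prop[OF H] induced_connected_iff[OF ind] by blast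
    show "subgraph H G" by (rule subgraphI_max_subgraph[OF H])
    fix K assume K: "H \<noteq> K" "subgraph H K" "subgraph K G"
    show "\<not> strongly_connected K"
    proof
      assume "strongly_connected K"
      moreover interpret K: wf_digraph K using K(3) by (auto simp: subgraph_def)
      have "Digraph_Component.connected K"
        using \<open>strongly_connected K\<close> K.reachable_mk_symmetricI
        by (auto simp: Digraph_Component.connected_def strongly_connected_def)
      then show False using H K unfolding max_subgraph_def by metis
    qed
  qed
next
  assume H: "max_subgraph strongly_connected H"
  then have ind: "induced_subgraph H G" by (rule induced_subgraphI_arc_mono) simp
  show "max_subgraph Digraph_Component.connected H"
  proof (rule max_subgraphI)
    show "Digraph_Component.connected H"
      using max_subgraph_prop[OF H] induced_connected_iff[OF ind] by blast
    show "subgraph H G" by (rule subgraphI_max_subgraph[OF H])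
    fix K assume K: "H \<noteq> K" "subgraph H K" "subgraph K G"
    show "\<not> Digraph_Component.connected K"
    proof
      assume conn: "Digraph_Component.connected K"
      have KV: "verts K \<subseteq> verts G" using K(3) by (auto simp: subgraph_def)
      \<comment> \<open>K need not be symmetric. The subgraph induced on its vertices is, and it
        still is connected and contains H.\<close>
      let ?L = "G \<restriction> verts K"
      have L: "subgraph ?L G" "subgraph K ?L" "induced_subgraph ?L G"
        using K(3) KV by (auto intro: subgraph_induce_subgraphI subgraph_induce_subgraphI2)
      have "Digraph_Component.connected ?L"
        using arc_mono_connected conn L(2) unfolding arc_mono_def by force
      then have "strongly_connected ?L" using induced_connected_iff[OF L(3)] by blast
      moreover have "subgraph H ?L" by (rule subgraph_trans[OF K(2) L(2)])
      ultimately have "H = ?L" using H L(1) unfolding max_subgraph_def by metis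
      then have "subgraph K H" using L(2) by simp
      then have "H = K" using K(2) by (auto simp: subgraph_def compatible_def)
      then show False using K(1) by blast
    qed
  qed
qed

lemma components_eq_sccs_verts: "components G = sccs_verts"
  unfolding components_def sccs_verts_conv sccs_altdef2 max_connected_subgraph_iff by simp

lemma reachable_component: "u \<in> verts G \<Longrightarrow> {w. u \<rightarrow>\<^sup>* w} \<in> components G"
  unfolding components_eq_sccs_verts sccs_verts_conv
  by (rule image_eqI[OF _ induce_reachable_is_in_sccs]) simp_all

lemma same_component_iff: "(\<exists>C\<in>components G. u \<in> C \<and> v \<in> C) \<longleftrightarrow> u \<rightarrow>\<^sup>* v"
proof
  assume uv: "u \<rightarrow>\<^sup>* v"
  then have "u \<in> verts G" by (rule reachable_in_verts)
  then show "\<exists>C\<in>components G. u \<in> C \<and> v \<in> C"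
    using uv by (intro bexI[OF _ reachable_component]) auto
qed (auto simp: components_eq_sccs_verts in_sccs_verts_conv_reachable)

text \<open>The set reachable from u is the least set without exit containing u.\<close>

lemma unreachable_iff:
  assumes u: "u \<in> verts G"
  shows "Y \<inter> {w. u \<rightarrow>\<^sup>* w} = {} \<longleftrightarrow> (\<exists>X. u \<in> X \<and> X \<inter> Y = {} \<and> no_exit G {} X)"
proof
  assume Y: "Y \<inter> {w. u \<rightarrow>\<^sup>* w} = {}"
  have "no_exit G {} {w. u \<rightarrow>\<^sup>* w}"
    unfolding no_exit_def using reachable_adj_trans reachable_in_verts(2) by auto
  moreover have "u \<in> {w. u \<rightarrow>\<^sup>* w}" using u by simp
  ultimately show "\<exists>X. u \<in> X \<and> X \<inter> Y = {} \<and> no_exit G {} X"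
    using Y by (metis inf_commute)
next
  assume "\<exists>X. u \<in> X \<and> X \<inter> Y = {} \<and> no_exit G {} X"
  then obtain X where X: "u \<in> X" "X \<inter> Y = {}" "no_exit G {} X" by blast
  have "w \<in> X" if "u \<rightarrow>\<^sup>* w" for w
    using that
  proof (induct rule: reachable_induct)
    case (step v w)
    moreover have "w \<in> verts G" using step.hyps(2) adj_in_verts(2) by simp
    ultimately show ?case using X(3) unfolding no_exit_def by auto
  qed (rule X(1))
  then show "Y \<inter> {w. u \<rightarrow>\<^sup>* w} = {}" using X(2) by blast
qed

lemma sym_digraph_delete_verts: "sym_digraph (delete_verts G R)"
  unfolding delete_verts_def by (intro induced_graph_imp_graph induced_induce) blast

lemma verts_delete_verts: "verts (delete_verts G R) = verts G - R"
  by (simp add: delete_verts_def)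

lemma no_exit_delete_verts: "no_exit (delete_verts G R) {} X \<longleftrightarrow> no_exit G R X"
proof -
  have "x \<rightarrow>\<^bsub>delete_verts G R\<^esub> y \<longleftrightarrow> x \<rightarrow> y" if "x \<in> verts G - R" "y \<in> verts G - R" for x y
    using that by (auto simp: delete_verts_def arcs_ends_conv)
  then have "(\<forall>x\<in>X. \<forall>y\<in>verts G - R - X. \<not> x \<rightarrow>\<^bsub>delete_verts G R\<^esub> y)
      \<longleftrightarrow> (\<forall>x\<in>X. \<forall>y\<in>verts G - R - X. \<not> x \<rightarrow> y)" if "X \<subseteq> verts G - R"
    using that by (intro ball_cong refl) (metis DiffD1 subsetD)
  then show ?thesis unfolding no_exit_def verts_delete_verts by auto
qed

lemma delete_verts_unreachable_iff:
  assumes "u \<in> verts G - R"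
  shows "Y \<inter> {w. u \<rightarrow>\<^sup>*\<^bsub>delete_verts G R\<^esub> w} = {} \<longleftrightarrow> (\<exists>X. u \<in> X \<and> X \<inter> Y = {} \<and> no_exit G R X)"
proof -
  interpret D: sym_digraph "delete_verts G R" by (rule sym_digraph_delete_verts)
  show ?thesis
    using D.unreachable_iff[of u Y] assms by (simp add: verts_delete_verts no_exit_delete_verts)
qed

lemma cutset_iff:
  "cutset G R \<longleftrightarrow> R \<subseteq> verts G \<and> (\<exists>X. no_exit G R X \<and> X \<noteq> {} \<and> verts G - R - X \<noteq> {})"
proof -
  interpret D: sym_digraph "delete_verts G R" by (rule sym_digraph_delete_verts)
  have "(verts G - R \<noteq> {} \<and> \<not> Digraph_Component.connected (delete_verts G R))
    \<longleftrightarrow> (\<exists>u\<in>verts G - R. \<exists>v\<in>verts G - R. \<not> u \<rightarrow>\<^sup>*\<^bsub>delete_verts G R\<^esub> v)"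
    unfolding D.connected_iff_strongly_connected strongly_connected_def verts_delete_verts by auto
  also have "\<dots> \<longleftrightarrow> (\<exists>u\<in>verts G - R. \<exists>v\<in>verts G - R. \<exists>X. u \<in> X \<and> v \<notin> X \<and> no_exit G R X)"
    using delete_verts_unreachable_iff[of _ R "{_}"] by (intro bex_cong refl) auto
  also have "\<dots> \<longleftrightarrow> (\<exists>X. no_exit G R X \<and> X \<noteq> {} \<and> verts G - R - X \<noteq> {})"
    using no_exit_subset[of G R] by blast
  finally show ?thesis unfolding cutset_def verts_delete_verts by blast
qed

text \<open>The first hypothesis ensures that some component exists. Without one,
  \<open>splits\<close> would hold even for A inside R.\<close>

lemma splits_iff:
  assumes R: "verts G - R \<noteq> {}" and A: "A \<subseteq> verts G"
  shows "splits G R A \<longleftrightarrow> (\<exists>X. no_exit G R X \<and> A \<inter> X \<noteq> {} \<and> A - R - X \<noteq> {})"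
proof -
  interpret D: sym_digraph "delete_verts G R" by (rule sym_digraph_delete_verts)
  have "splits G R A \<longleftrightarrow> (\<exists>u\<in>A - R. \<exists>v\<in>A - R. \<not> u \<rightarrow>\<^sup>*\<^bsub>delete_verts G R\<^esub> v)"
  proof
    assume s: "splits G R A"
    have comp: "{w. u \<rightarrow>\<^sup>*\<^bsub>delete_verts G R\<^esub> w} \<in> components (delete_verts G R)" if "u \<in> verts G - R" for u
      using that by (intro D.reachable_component) (simp add: verts_delete_verts)
    have "A - R \<noteq> {}"
      using s R comp unfolding splits_def by blast
    then obtain u where u: "u \<in> A - R" by blast
    then have "\<not> A - R \<subseteq> {w. u \<rightarrow>\<^sup>*\<^bsub>delete_verts G R\<^esub> w}"
      using s comp[of u] A unfolding splits_def by blast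
    then show "\<exists>u\<in>A - R. \<exists>v\<in>A - R. \<not> u \<rightarrow>\<^sup>*\<^bsub>delete_verts G R\<^esub> v"
      using u by blast
  next
    assume "\<exists>u\<in>A - R. \<exists>v\<in>A - R. \<not> u \<rightarrow>\<^sup>*\<^bsub>delete_verts G R\<^esub> v"
    then show "splits G R A" unfolding splits_def using D.same_component_iff by blast
  qed
  also have "\<dots> \<longleftrightarrow> (\<exists>u\<in>A - R. \<exists>v\<in>A - R. \<exists>X. u \<in> X \<and> v \<notin> X \<and> no_exit G R X)"
    using delete_verts_unreachable_iff[of _ R "{_}"] A by (intro bex_cong refl) auto
  also have "\<dots> \<longleftrightarrow> (\<exists>X. no_exit G R X \<and> A \<inter> X \<noteq> {} \<and> A - R - X \<noteq> {})"
    using no_exit_subset[of G R] by blast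
  finally show ?thesis .
qed

lemma separates_vertex_iff:
  assumes "v \<in> verts G"
  shows "separates G R {v} A \<longleftrightarrow> v \<notin> R \<and> \<not> A \<subseteq> R \<and> (\<exists>X. v \<in> X \<and> X \<inter> A = {} \<and> no_exit G R X)"
proof (cases "v \<in> R")
  case False
  interpret D: sym_digraph "delete_verts G R" by (rule sym_digraph_delete_verts)
  have sub: "{w. v \<rightarrow>\<^sup>*\<^bsub>delete_verts G R\<^esub> w} \<subseteq> - R"
    using D.reachable_in_verts(2) by (auto simp: delete_verts_def)
  have "separates G R {v} A \<longleftrightarrow> \<not> A \<subseteq> R \<and> (A - R) \<inter> {w. v \<rightarrow>\<^sup>*\<^bsub>delete_verts G R\<^esub> w} = {}"
    unfolding separates_def D.same_component_iff using False by auto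
  also have "\<dots> \<longleftrightarrow> \<not> A \<subseteq> R \<and> A \<inter> {w. v \<rightarrow>\<^sup>*\<^bsub>delete_verts G R\<^esub> w} = {}"
    using sub by blast
  finally show ?thesis
    using delete_verts_unreachable_iff[of v R A] assms False by simp
qed (simp add: separates_def)

end

section \<open>Chromatic numbers of parts and blocks\<close>

lemma dominates_restrict_iff: "u \<rightarrow>\<^bsub>with_proj H \<restriction> A\<^esub> v \<longleftrightarrow> (u, v) \<in> parcs H \<and> u \<in> A \<and> v \<in> A"
  by (auto simp: arcs_ends_conv)

lemma chromatic_number_restrict:
  "chromatic_number (with_proj H \<restriction> A) = (LEAST k. \<exists>c. colouring (parcs H) k A c)"
  unfolding chromatic_number_def colouring_def dominates_restrict_iff
  by (intro arg_cong[where f = Least] ext arg_cong[where f = Ex]) auto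

lemma ex_colouring:
  assumes "finite A" "irrefl F"
  shows "\<exists>k c. colouring F k A c"
proof -
  obtain c and n :: nat where c: "c ` A = {i. i < n}" "inj_on c A"
    using finite_imp_inj_to_nat_seg[OF assms(1)] by blast
  then have "colouring F n A c"
    using assms(2) unfolding colouring_def irrefl_def by (auto dest: inj_onD)
  then show ?thesis by blast
qed

lemma chromatic_number_le:
  "colouring (parcs H) k A c \<Longrightarrow> chromatic_number (with_proj H \<restriction> A) \<le> k"
  unfolding chromatic_number_restrict by (rule Least_le) blast

lemma chromatic_number_colouring:
  assumes "finite A" "irrefl (parcs H)"
  shows "\<exists>c. colouring (parcs H) (chromatic_number (with_proj H \<restriction> A)) A c"
  unfolding chromatic_number_restrict
  using LeastI_ex[of "\<lambda>k. \<exists>c. colouring (parcs H) k A c"] ex_colouring[OF assms] by blast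

lemma chromatic_number_restrict_verts:
  assumes "pair_wf_digraph H"
  shows "chromatic_number (with_proj H \<restriction> pverts H) = chromatic_number (with_proj H)"
proof -
  interpret pair_wf_digraph H by (rule assms)
  have "(u, v) \<in> parcs H \<and> u \<in> pverts H \<and> v \<in> pverts H \<longleftrightarrow> (u, v) \<in> parcs H" for u v
    using in_arcsD1 in_arcsD2 by blast
  then show ?thesis
    unfolding chromatic_number_def dominates_restrict_iff by simp
qed

text \<open>Replaces the supremum by an attained natural number and isolates the empty family, where
  the supremum is -\<infinity>.\<close>

lemma max_chromatic_cases:
  assumes "finite \<A>"
  obtains "\<A> = {}" | m where "max_chromatic G \<A> = ereal (real m)"
    "\<And>A. A \<in> \<A> \<Longrightarrow> chromatic_number (G \<restriction> A) \<le> m" "\<exists>A\<in>\<A>. chromatic_number (G \<restriction> A) = m"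
proof (cases "\<A> = {}")
  case False
  let ?f = "\<lambda>A. chromatic_number (G \<restriction> A)"
  define m where "m = Max (?f ` \<A>)"
  have le: "\<And>A. A \<in> \<A> \<Longrightarrow> ?f A \<le> m" using assms unfolding m_def by auto
  have "m \<in> ?f ` \<A>" unfolding m_def using assms False by (intro Max_in) auto
  then obtain A where A: "A \<in> \<A>" "?f A = m" by auto
  have "max_chromatic G \<A> = ereal (real m)"
    unfolding max_chromatic_def
  proof (rule antisym)
    show "(SUP A\<in>\<A>. ereal (real (?f A))) \<le> ereal (real m)"
      using le by (intro SUP_least) simp
    show "ereal (real m) \<le> (SUP A\<in>\<A>. ereal (real (?f A)))"
      using A by (intro SUP_upper2[of A]) auto
  qed
  then show ?thesis using that(2)[of m] le A by blast
qed

section \<open>Translation of the graph notions into separations\<close>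

locale biconnected_graph = pair_graph G for G :: "'a pair_pre_digraph" +
  assumes biconnected_G: "k_connected 2 G"

sublocale biconnected_graph \<subseteq> biconnected "pverts G" "parcs G"
proof
  fix S X Y
  assume S: "S \<subseteq> pverts G" "X \<union> Y = pverts G - S" "X \<inter> Y = {}" "X \<noteq> {}" "Y \<noteq> {}"
    "\<And>x y. x \<in> X \<Longrightarrow> y \<in> Y \<Longrightarrow> (x, y) \<notin> parcs G"
  have "no_exit G S X" using S unfolding no_exit_def by auto
  moreover have "pverts G - S - X \<noteq> {}" using S by blast
  ultimately have "cutset G S" using S cutset_iff by auto
  then show "2 \<le> card S" using biconnected_G unfolding k_connected_def by (meson not_le)
next
  show "(x, x) \<notin> parcs G" for x using no_loops' by blast
qed (use arcs_symmetric in_arcsD2 pair_finite_verts in auto)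

context biconnected_graph begin

lemma sep_iff: "sep S X Y \<longleftrightarrow> S \<subseteq> pverts G \<and> no_exit G S X \<and> X \<noteq> {} \<and> pverts G - S - X \<noteq> {}
    \<and> Y = pverts G - S - X"
  unfolding sep_def no_exit_def by auto

lemma two_cutsets_eq: "two_cutsets G = Collect pair_cut"
  unfolding two_cutsets_def pair_cut_def sep_iff cutset_iff by auto

lemma splits_iff_divides:
  assumes R: "pair_cut R" and A: "A \<subseteq> pverts G"
  shows "splits G R A \<longleftrightarrow> divides R A"
proof -
  have "R \<subseteq> pverts G" "pverts G - R \<noteq> {}"
    using R unfolding pair_cut_def sep_iff by auto
  then have "splits G R A \<longleftrightarrow> (\<exists>X. no_exit G R X \<and> A \<inter> X \<noteq> {} \<and> A - R - X \<noteq> {})"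
    using splits_iff[of R A] A by simp
  also have "\<dots> \<longleftrightarrow> divides R A"
    unfolding divides_def sep_iff using A \<open>R \<subseteq> pverts G\<close> by blast
  finally show ?thesis .
qed

lemma pair_cut_sub: "pair_cut S \<Longrightarrow> S \<subseteq> pverts G"
  unfolding pair_cut_def sep_def by blast

lemma single_cutsets_eq: "single_cutsets G = Collect single"
proof -
  \<comment> \<open>This covers T = S, which \<open>single\<close> includes in its quantifier and
    \<open>single_cutsets\<close> excludes.\<close>
  have self: "\<not> divides S S" for S
    unfolding divides_def sep_def by blast
  have "S \<in> single_cutsets G \<longleftrightarrow> single S" for S
    unfolding single_cutsets_def two_cutsets_eq independent_cutsets_def single_def
    using splits_iff_divides pair_cut_sub self by auto
  then show ?thesis by blast
qed

lemma separates_single_iff: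
  assumes "v \<in> pverts G" "A \<subseteq> pverts G" "single S"
  shows "separates G S {v} A \<longleftrightarrow> (\<exists>X Y. sep S X Y \<and> v \<in> X \<and> A \<inter> X = {} \<and> A \<inter> Y \<noteq> {})"
proof -
  have "S \<subseteq> pverts G" using pair_cut_sub singleD(2)[OF assms(3)] by blast
  have eq: "v \<notin> S \<and> \<not> A \<subseteq> S \<and> v \<in> X \<and> X \<inter> A = {} \<and> no_exit G S X
      \<longleftrightarrow> sep S X (pverts G - S - X) \<and> v \<in> X \<and> A \<inter> X = {} \<and> A \<inter> (pverts G - S - X) \<noteq> {}" for X
    using no_exit_subset[of G S X] assms(2) \<open>S \<subseteq> pverts G\<close> unfolding sep_iff by auto
  have "separates G S {v} A
      \<longleftrightarrow> (\<exists>X. v \<notin> S \<and> \<not> A \<subseteq> S \<and> v \<in> X \<and> X \<inter> A = {} \<and> no_exit G S X)"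
    using separates_vertex_iff assms(1) by simp
  also have "\<dots> \<longleftrightarrow> (\<exists>X. sep S X (pverts G - S - X) \<and> v \<in> X \<and> A \<inter> X = {} \<and> A \<inter> (pverts G - S - X) \<noteq> {})"
    unfolding eq by (rule refl)
  also have "\<dots> \<longleftrightarrow> (\<exists>X Y. sep S X Y \<and> v \<in> X \<and> A \<inter> X = {} \<and> A \<inter> Y \<noteq> {})"
    unfolding sep_iff by auto
  finally show ?thesis .
qed

lemma parts_eq: "parts G = Collect part"
proof -
  have "A \<in> parts G \<longleftrightarrow> part A" for A
  proof (cases "A \<subseteq> pverts G")
    case True
    have "(\<forall>S. single S \<longrightarrow> \<not> splits G S A) \<longleftrightarrow> (\<forall>S. single S \<longrightarrow> \<not> divides S A)"
      using splits_iff_divides[OF _ True] singleD(2) by blast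
    moreover have "(\<exists>S. single S \<and> separates G S {v} A)
        \<longleftrightarrow> (\<exists>S X Y. single S \<and> sep S X Y \<and> v \<in> X \<and> A \<inter> X = {} \<and> A \<inter> Y \<noteq> {})"
      if "v \<in> pverts G - A" for v
    proof -
      have v: "v \<in> pverts G" using that by simp
      have "(\<exists>S. single S \<and> separates G S {v} A)
          \<longleftrightarrow> (\<exists>S. single S \<and> (\<exists>X Y. sep S X Y \<and> v \<in> X \<and> A \<inter> X = {} \<and> A \<inter> Y \<noteq> {}))"
        by (intro arg_cong[where f = Ex] ext conj_cong refl separates_single_iff[OF v True])
      then show ?thesis by simp
    qed
    then have "(\<forall>v\<in>pverts G - A. \<exists>S. single S \<and> separates G S {v} A) \<longleftrightarrow> enclosed A"
      unfolding enclosed_def using True by simp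
    ultimately show ?thesis
      unfolding parts_def part_def single_cutsets_eq using True by (simp add: Bex_def conj_commute)
  qed (simp add: parts_def part_def enclosed_def)
  then show ?thesis by blast
qed

lemma add_single_edges_eq: "add_single_edges G = \<lparr>pverts = pverts G, parcs = parcs G \<union> virtual\<rparr>"
  unfolding add_single_edges_def virtual_def single_cutsets_eq by simp

lemma pverts_add_single_edges: "pverts (add_single_edges G) = pverts G"
  and parcs_add_single_edges: "parcs (add_single_edges G) = parcs G \<union> virtual"
  unfolding add_single_edges_eq by simp_all

lemma virtualD: "(a, b) \<in> virtual \<Longrightarrow> a \<in> pverts G \<and> b \<in> pverts G \<and> a \<noteq> b \<and> (b, a) \<in> virtual"
  using pair_cut_sub singleD(1,2)[of "{a, b}"] by (auto simp: virtual_def insert_commute)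

lemma pair_sym_digraph_add_single_edges: "pair_sym_digraph (add_single_edges G)"
proof
  show "symmetric (add_single_edges G)"
    unfolding symmetric_def add_single_edges_eq
    using arcs_symmetric virtualD by (auto intro!: symI)
qed (use in_arcsD1 in_arcsD2 virtualD in \<open>auto simp: add_single_edges_eq\<close>)

lemma part_subset: "part A \<Longrightarrow> A \<subseteq> pverts G"
  unfolding part_def enclosed_def by blast

text \<open>Used contrapositively: a part that is not a block fails \<open>triconnected_part\<close>
  and can be coloured greedily.\<close>

lemma triconnected_part_block:
  assumes A: "part A" and tri: "triconnected_part A"
  shows "A \<in> blocks G"
proof -
  interpret G': pair_sym_digraph "add_single_edges G" by (rule pair_sym_digraph_add_single_edges)
  have ind: "induced_subgraph (add_single_edges G \<restriction> A) (add_single_edges G)"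
    by (rule G'.induced_induce) (use part_subset[OF A] in \<open>simp add: pverts_add_single_edges\<close>)
  interpret H: sym_digraph "add_single_edges G \<restriction> A" by (rule G'.induced_graph_imp_graph[OF ind])
  have "\<not> card R < 3" if R: "cutset (add_single_edges G \<restriction> A) R" for R
  proof
    assume "card R < 3"
    obtain X where X: "R \<subseteq> A" "X \<noteq> {}" "A - R - X \<noteq> {}" "no_exit (add_single_edges G \<restriction> A) R X"
      using R unfolding H.cutset_iff by auto
    from X(4) have XA: "X \<subseteq> A - R" "\<forall>x\<in>X. \<forall>y\<in>A - R - X. (x, y) \<notin> parcs G \<union> virtual"
      unfolding no_exit_def dominates_restrict_iff parcs_add_single_edges by auto
    have "R \<subseteq> A \<and> card R \<le> 2 \<and> X \<union> (A - R - X) = A - R \<and> X \<inter> (A - R - X) = {} \<and> X \<noteq> {}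
      \<and> A - R - X \<noteq> {} \<and> (\<forall>x\<in>X. \<forall>y\<in>A - R - X. (x, y) \<notin> parcs G \<union> virtual)"
      using X(1-3) XA \<open>card R < 3\<close> by auto
    then show False using tri unfolding triconnected_part_def by blast
  qed
  then have "k_connected 3 (add_single_edges G \<restriction> A)"
    using tri unfolding k_connected_def triconnected_part_def by auto
  then show ?thesis using A unfolding blocks_def parts_eq by blast
qed

lemma irrefl_arcs: "irrefl (parcs G)" "irrefl (parcs (add_single_edges G))"
  using irrefl_E virtualD unfolding irrefl_def parcs_add_single_edges by blast+

lemma finite_part: "part A \<Longrightarrow> finite A"
  using part_subset finite_V finite_subset by blast

lemma finite_parts: "finite (parts G)" "finite (blocks G)"
proof -
  have "parts G \<subseteq> Pow (pverts G)" using part_subset unfolding parts_eq by blast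
  then show "finite (parts G)" using finite_V finite_subset by blast
  then show "finite (blocks G)" unfolding blocks_def by simp
qed

lemma chromatic_number_whole: "chromatic_number G = chromatic_number (G \<restriction> pverts G)"
    "chromatic_number (add_single_edges G) = chromatic_number (add_single_edges G \<restriction> pverts G)"
proof -
  interpret G': pair_sym_digraph "add_single_edges G" by (rule pair_sym_digraph_add_single_edges)
  show "chromatic_number G = chromatic_number (G \<restriction> pverts G)"
    using chromatic_number_restrict_verts[of G] pair_wf_digraph by simp
  show "chromatic_number (add_single_edges G) = chromatic_number (add_single_edges G \<restriction> pverts G)"
    using chromatic_number_restrict_verts[OF G'.pair_wf_digraph_axioms]
    by (simp add: pverts_add_single_edges)
qed

section \<open>The bounds on the chromatic number\<close>

lemma chromatic_number_mono: "chromatic_number G \<le> chromatic_number (add_single_edges G)"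
proof -
  obtain c where "colouring (parcs (add_single_edges G)) (chromatic_number (add_single_edges G)) (pverts G) c"
    using chromatic_number_colouring[OF finite_V irrefl_arcs(2)] chromatic_number_whole(2) by auto
  then have "colouring (parcs G) (chromatic_number (add_single_edges G)) (pverts G) c"
    unfolding colouring_def parcs_add_single_edges by blast
  then show ?thesis using chromatic_number_le chromatic_number_whole(1) by metis
qed

text \<open>Without parts, the hypothesis of \<open>colouring_V_from_blocks\<close> holds vacuously
  for K = 0, and a nonempty V would be coloured with no colours.\<close>

lemma parts_nonempty: "parts G \<noteq> {}"
proof
  assume "parts G = {}"
  then have "\<exists>c. colouring (parcs G) 0 (pverts G) c"
    by (intro colouring_V_from_blocks) (auto simp: parts_eq)
  then have "pverts G = {}" unfolding colouring_def by auto
  then show False using biconnected_G unfolding k_connected_def by simp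
qed

text \<open>Gluing gives one inequality; restricting a colouring of the whole graph to a part that
  attains the maximum gives the other.\<close>

lemma chromatic_add_single_edges:
  "ereal (real (chromatic_number (add_single_edges G))) = max_chromatic (add_single_edges G) (parts G)"
  (is "ereal (real ?\<chi>) = _")
proof (rule max_chromatic_cases[OF finite_parts(1), where G = "add_single_edges G"])
  fix m
  assume m: "max_chromatic (add_single_edges G) (parts G) = ereal (real m)"
    "\<And>A. A \<in> parts G \<Longrightarrow> chromatic_number (add_single_edges G \<restriction> A) \<le> m"
    "\<exists>A\<in>parts G. chromatic_number (add_single_edges G \<restriction> A) = m"
  have "\<exists>c. colouring (parcs G \<union> virtual) m (pverts G) c"
  proof (rule colouring_V_with_virtual)
    fix A assume A: "part A"
    then obtain c where "colouring (parcs G \<union> virtual) (chromatic_number (add_single_edges G \<restriction> A)) A c"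
      using chromatic_number_colouring[OF finite_part irrefl_arcs(2)]
      unfolding parcs_add_single_edges by blast
    moreover have "chromatic_number (add_single_edges G \<restriction> A) \<le> m" using m(2) A parts_eq by blast
    ultimately show "\<exists>c. colouring (parcs G \<union> virtual) m A c"
      using colouring_mono by blast
  qed
  then have "?\<chi> \<le> m"
    using chromatic_number_le[of "add_single_edges G"]
    unfolding chromatic_number_whole(2) parcs_add_single_edges by blast
  moreover have "m \<le> ?\<chi>"
  proof -
    obtain A where A: "A \<in> parts G" "chromatic_number (add_single_edges G \<restriction> A) = m" using m(3) by blast
    obtain c where "colouring (parcs (add_single_edges G)) ?\<chi> (pverts G) c"
      using chromatic_number_colouring[OF finite_V irrefl_arcs(2)] chromatic_number_whole(2) by auto
    then have "colouring (parcs (add_single_edges G)) ?\<chi> A c"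
      by (rule colouring_subset) (use A(1) part_subset[of A] in \<open>simp add: parts_eq\<close>)
    then show ?thesis using chromatic_number_le A(2) by metis
  qed
  ultimately show ?thesis using m(1) by simp
qed (use parts_nonempty in blast)

lemma chromatic_le_if_blocks:
  assumes "\<And>A. A \<in> parts G \<Longrightarrow> chromatic_number (G \<restriction> A) < K \<or> 3 \<le> K \<and> A \<notin> blocks G"
  shows "chromatic_number G \<le> K"
proof -
  have "\<exists>c. colouring (parcs G) K (pverts G) c"
  proof (rule colouring_V_from_blocks)
    fix A assume A: "part A"
    then have "chromatic_number (G \<restriction> A) < K \<or> 3 \<le> K \<and> \<not> triconnected_part A"
      using assms[of A] triconnected_part_block unfolding parts_eq by blast
    then show "(\<exists>k<K. \<exists>c. colouring (parcs G) k A c) \<or> 3 \<le> K \<and> \<not> triconnected_part A"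
      using chromatic_number_colouring[OF finite_part[OF A] irrefl_arcs(1)] by blast
  qed
  then show ?thesis
    unfolding chromatic_number_whole(1) using chromatic_number_le by blast
qed

lemma chromatic_le_parts: "ereal (real (chromatic_number G)) \<le> max_chromatic G (parts G) + 1"
proof (rule max_chromatic_cases[OF finite_parts(1), where G = G])
  fix m
  assume m: "max_chromatic G (parts G) = ereal (real m)"
    "\<And>A. A \<in> parts G \<Longrightarrow> chromatic_number (G \<restriction> A) \<le> m"
  have "chromatic_number G \<le> m + 1"
    by (rule chromatic_le_if_blocks) (use m(2) in fastforce)
  then show ?thesis unfolding m(1) one_ereal_def by simp
qed (use parts_nonempty in blast)

text \<open>With \<open>K = max 3 (m + 1)\<close> every block has a spare colour and every other
  part has three colours available. If there are no blocks, K = 3 suffices.\<close>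

lemma chromatic_le_blocks:
  "ereal (real (chromatic_number G)) \<le> max 3 (max_chromatic G (blocks G) + 1)"
proof (rule max_chromatic_cases[OF finite_parts(2), where G = G])
  assume "blocks G = {}"
  then have "chromatic_number G \<le> 3"
    by (intro chromatic_le_if_blocks) auto
  then have "ereal (real (chromatic_number G)) \<le> ereal (real 3)"
    unfolding ereal_less_eq of_nat_le_iff .
  then show ?thesis by (simp add: le_max_iff_disj)
next
  fix m
  assume m: "max_chromatic G (blocks G) = ereal (real m)"
    "\<And>A. A \<in> blocks G \<Longrightarrow> chromatic_number (G \<restriction> A) \<le> m"
  have "chromatic_number G \<le> max 3 (m + 1)"
    by (rule chromatic_le_if_blocks) (use m(2) in fastforce)
  then have "ereal (real (chromatic_number G)) \<le> ereal (real (max 3 (m + 1)))"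
    unfolding ereal_less_eq of_nat_le_iff .
  also have "\<dots> = max 3 (ereal (real m) + 1)"
    unfolding one_ereal_def by (simp add: max_def)
  finally show ?thesis unfolding m(1) .
qed

end

theorem theorem4:
  fixes G :: "'a pair_pre_digraph"
  assumes "pair_graph G"
    and "k_connected 2 G"
  shows "(chromatic_number G \<le> chromatic_number (add_single_edges G)
        \<and> ereal (real (chromatic_number (add_single_edges G)))
            = max_chromatic (add_single_edges G) (parts G))
      \<and> ereal (real (chromatic_number G)) \<le> max_chromatic G (parts G) + 1
      \<and> ereal (real (chromatic_number G)) \<le> max 3 (max_chromatic G (blocks G) + 1)"
proof -
  interpret biconnected_graph G
    using assms by (simp add: biconnected_graph_def biconnected_graph_axioms_def)
  show ?thesis
    using chromatic_number_mono chromatic_add_single_edges chromatic_le_parts chromatic_le_blocks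
    by blast
qed

end
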